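(* If $(M,F)$ is a connected complex Berwald space of complex dimension $2$ with $R_{\bar0k\bar00}=R_{\bar00\bar0k}$ for $k=1,2$ and $|A|\neq0$ (i.e. $A$ not identically zero), then $R_{\bar rj\bar hk}=0$ for all indices.
   Context: $M$ is a complex manifold with $\dim_{\mathbb C}M=2$; $T'M$ is its holomorphic tangent bundle with local coordinates $(z^k,\eta^k)_{k=1,2}$; $\widetilde{T'M}$ is $T'M$ minus the zero section. A complex Finsler space $(M,F)$: $F:T'M\to[0,\infty)$ is continuous, $L:=F^2$ is smooth on $\widetilde{T'M}$, $F(z,\eta)=0$ iff $\eta=0$, $F(z,\lambda\eta)=|\lambda|F(z,\eta)$ for all $\lambda\in\mathbb C$, and the Hermitian matrix $g_{i\bar j}:=\partial^2L/\partial\eta^i\partial\bar\eta^j$ is positive definite on $\widetilde{T'M}$. "Connected" means $M$ is connected. Repeated indices are summed over $\{1,2\}$; everything lives on $\widetilde{T'M}$. $(g^{\bar m i})$ is the inverse matrix: $g^{\bar m i}g_{j\bar m}=\delta^i_j$. Chern–Finsler connection: $\dot\partial_k:=\partial/\partial\eta^k$, $N^k_j:=g^{\bar mk}\frac{\partial g_{l\bar m}}{\partial z^j}\eta^l$, $\delta_k:=\frac{\partial}{\partial z^k}-N^j_k\dot\partial_j$, $\delta_{\bar k}:=\overline{\delta_k}$, $L^i_{jk}:=g^{\bar li}\delta_kg_{j\bar l}$, $C^i_{jk}:=g^{\bar li}\dot\partial_kg_{j\bar l}$. Curvature: $R^i_{j\bar hk}:=-\delta_{\bar h}L^i_{jk}-\delta_{\bar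 h}(N^l_k)C^i_{jl}$, $R_{\bar rj\bar hk}:=g_{i\bar r}R^i_{j\bar hk}$. An index $0$ (resp. $\bar0$) means contraction with $\eta$ (resp. $\bar\eta$): $R_{\bar0k\bar00}=R_{\bar rk\bar hj}\bar\eta^r\bar\eta^h\eta^j$, $R_{\bar00\bar0k}=R_{\bar rj\bar hk}\bar\eta^r\eta^j\bar\eta^h$. With $T^i_{jk}:=L^i_{jk}-L^i_{kj}$, the space is Kähler if $T^i_{jk}\eta^j=0$ (known to be equivalent to $T^i_{jk}=0$); it is a complex Berwald space if it is Kähler and $L^i_{jk}=L^i_{jk}(z)$ does not depend on $\eta$. In a fixed local chart: $l_i:=\frac1Fg_{i\bar j}\bar\eta^j$, $g:=\det(g_{i\bar j})$, $m^1:=-l_2/\sqrt g$, $m^2:=l_1/\sqrt g$, $A:=m^jm^kl_hC^h_{kj}$ ($|A|$ is independent of the chart; $A\equiv0$ means $g_{i\bar j}$ depends on $z$ only). *)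

theory Defs
  imports "HOL-Analysis.Analysis"
begin

section \<open>Smooth and holomorphic maps\<close>

text \<open>Intended for open sets \<open>S\<close> in finite-dimensional spaces.\<close>

primrec Ck_on :: "nat \<Rightarrow> ('a::real_normed_vector \<Rightarrow> 'b::real_normed_vector) \<Rightarrow> 'a set \<Rightarrow> bool" where
  "Ck_on 0 f S \<longleftrightarrow> continuous_on S f"
| "Ck_on (Suc k) f S \<longleftrightarrow> (\<forall>x\<in>S. f differentiable (at x)) \<and>
     (\<forall>v. Ck_on k (\<lambda>x. frechet_derivative f (at x) v) S)"

definition smooth_on :: "('a::real_normed_vector \<Rightarrow> 'b::real_normed_vector) \<Rightarrow> 'a set \<Rightarrow> bool" where
  "smooth_on f S \<longleftrightarrow> (\<forall>k. Ck_on k f S)"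

definition holomorphic_vec_on ::
    "(complex^'n \<Rightarrow> complex^'m) \<Rightarrow> (complex^'n) set \<Rightarrow> bool" where
  "holomorphic_vec_on f S \<longleftrightarrow>
     (\<forall>x\<in>S. \<exists>D. (f has_derivative D) (at x) \<and> Vector_Spaces.linear (*s) (*s) D)"


section \<open>Complex manifolds and the holomorphic tangent bundle\<close>

text \<open>A chart is a pair of its domain and its coordinate map; the values of the map outside the
  domain are irrelevant.\<close>

type_synonym ('m, 'n) chart = "'m set \<times> ('m \<Rightarrow> complex^'n)"

definition transition :: "('m, 'n::finite) chart \<Rightarrow> ('m, 'n) chart \<Rightarrow> complex^'n \<Rightarrow> complex^'n" where
  "transition c d = snd d \<circ> inv_into (fst c) (snd c)"

definition complex_manifold :: "'m topology \<Rightarrow> ('m, 'n::finite) chart set \<Rightarrow> bool" where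
  "complex_manifold X \<A> \<longleftrightarrow>
     Hausdorff_space X \<and> second_countable X \<and>
     topspace X = (\<Union>c\<in>\<A>. fst c) \<and>
     (\<forall>(U, \<phi>)\<in>\<A>. openin X U \<and> open (\<phi> ` U) \<and>
        homeomorphic_map (subtopology X U) (top_of_set (\<phi> ` U)) \<phi>) \<and>
     (\<forall>c\<in>\<A>. \<forall>d\<in>\<A>. holomorphic_vec_on (transition c d) (snd c ` (fst c \<inter> fst d)))"

text \<open>A holomorphic tangent vector at \<open>p\<close> is the family of its component vectors in all charts
  around \<open>p\<close>, any two of which are related by the Jacobian of the change of coordinates.
  The components in charts that do not contain \<open>p\<close> are set to \<open>0\<close>.\<close>

type_synonym ('m, 'n) tvec = "('m, 'n) chart \<Rightarrow> complex^'n"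

definition holo_tangent_space ::
    "('m, 'n::finite) chart set \<Rightarrow> 'm \<Rightarrow> ('m, 'n) tvec set" where
  "holo_tangent_space \<A> p = {v.
     (\<forall>c\<in>\<A>. \<forall>d\<in>\<A>. p \<in> fst c \<and> p \<in> fst d \<longrightarrow>
        v d = frechet_derivative (transition c d) (at (snd c p)) (v c)) \<and>
     (\<forall>c. \<not> (c \<in> \<A> \<and> p \<in> fst c) \<longrightarrow> v c = 0)}"

definition holo_tangent_bundle ::
    "'m topology \<Rightarrow> ('m, 'n::finite) chart set \<Rightarrow> ('m \<times> ('m, 'n) tvec) set" where
  "holo_tangent_bundle X \<A> = Sigma (topspace X) (holo_tangent_space \<A>)"

text \<open>The induced chart \<open>(p, v) \<mapsto> (z, \<eta>)\<close> of the bundle over the domain of \<open>c\<close>.\<close>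

definition bundle_chart ::
    "('m, 'n::finite) chart \<Rightarrow> 'm \<times> ('m, 'n) tvec \<Rightarrow> (complex^'n) \<times> (complex^'n)" where
  "bundle_chart c = (\<lambda>(p, v). (snd c p, v c))"

definition local_rep ::
    "('m, 'n::finite) chart set \<Rightarrow> ('m \<times> ('m, 'n) tvec \<Rightarrow> real) \<Rightarrow> ('m, 'n) chart \<Rightarrow>
     (complex^'n) \<times> (complex^'n) \<Rightarrow> real" where
  "local_rep \<A> F c = F \<circ> inv_into (Sigma (fst c) (holo_tangent_space \<A>)) (bundle_chart c)"

definition chart_range :: "('m, 'n::finite) chart \<Rightarrow> ((complex^'n) \<times> (complex^'n)) set" where
  "chart_range c = (snd c ` fst c) \<times> UNIV"

definition slit_range :: "('m, 'n::finite) chart \<Rightarrow> ((complex^'n) \<times> (complex^'n)) set" where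
  "slit_range c = (snd c ` fst c) \<times> (UNIV - {0})"

lemma transition_cocycle:
  fixes \<A> :: "('m, 'n::finite) chart set"
  assumes M: "complex_manifold X \<A>" and c: "c \<in> \<A>" and d: "d \<in> \<A>" and e: "e \<in> \<A>"
    and p: "p \<in> fst c" "p \<in> fst d" "p \<in> fst e"
  shows "frechet_derivative (transition c e) (at (snd c p)) w =
         frechet_derivative (transition d e) (at (snd d p))
           (frechet_derivative (transition c d) (at (snd c p)) w)"
proof -
  have chart: "openin X (fst a)" "open (snd a ` fst a)"
    "homeomorphic_map (subtopology X (fst a)) (top_of_set (snd a ` fst a)) (snd a)"
    if "a \<in> \<A>" for a
    using M that unfolding complex_manifold_def by (auto simp: case_prod_beta)
  have diff: "transition a b differentiable (at (snd a p))"
    if "a \<in> \<A>" "b \<in> \<A>" "p \<in> fst a" "p \<in> fst b" for a b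
    using M that unfolding complex_manifold_def holomorphic_vec_on_def differentiable_def
    by (meson IntI imageI)
  have inj: "inj_on (snd a) (fst a)" if "a \<in> \<A>" for a
    using homeomorphic_imp_injective_map[OF chart(3)[OF that]] openin_subset[OF chart(1)[OF that]]
    by (simp add: topspace_subtopology Int_absorb1)
  let ?S = "snd c ` (fst c \<inter> fst d)"
  have "openin (subtopology X (fst c)) (fst c \<inter> fst d)"
    by (rule openin_subtopology_Int2[OF chart(1)[OF d]])
  then have "openin (top_of_set (snd c ` fst c)) ?S"
    using homeomorphic_map_openness[OF chart(3)[OF c], of "fst c \<inter> fst d"]
      openin_subset[OF chart(1)[OF c]] by (simp add: Int_absorb1)
  then have oS: "open ?S"
    using openin_open_eq[OF chart(2)[OF c]] by simp
  have pS: "snd c p \<in> ?S" using p by blast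
  have tp: "transition c d (snd c p) = snd d p"
    using p inj[OF c] by (simp add: transition_def)
  have eq: "transition c e x = (transition d e \<circ> transition c d) x" if "x \<in> ?S" for x
    using that inj[OF c] inj[OF d] by (auto simp: transition_def)
  have "((transition d e \<circ> transition c d) has_derivative
      (frechet_derivative (transition d e) (at (snd d p)) \<circ>
       frechet_derivative (transition c d) (at (snd c p)))) (at (snd c p))"
    using diff[OF c d p(1,2)] diff[OF d e p(2,3)]
    by (intro diff_chain_at) (simp_all add: tp frechet_derivative_works)
  then have "(transition c e has_derivative
      (frechet_derivative (transition d e) (at (snd d p)) \<circ>
       frechet_derivative (transition c d) (at (snd c p)))) (at (snd c p))"
    by (rule has_derivative_transform_within_open[OF _ oS pS]) (simp add: eq)
  from fun_cong[OF frechet_derivative_at[OF this], of w] show ?thesis by simp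
qed

lemma bij_betw_bundle_chart:
  fixes \<A> :: "('m, 'n::finite) chart set"
  assumes M: "complex_manifold X \<A>" and c: "c \<in> \<A>"
  shows "bij_betw (bundle_chart c) (Sigma (fst c) (holo_tangent_space \<A>)) (chart_range c)"
proof -
  have hm: "homeomorphic_map (subtopology X (fst c)) (top_of_set (snd c ` fst c)) (snd c)"
    "openin X (fst c)"
    using M c unfolding complex_manifold_def by (auto simp: case_prod_beta)
  have inj: "inj_on (snd c) (fst c)"
    using homeomorphic_imp_injective_map[OF hm(1)] openin_subset[OF hm(2)]
    by (simp add: topspace_subtopology Int_absorb1)
  have cid: "frechet_derivative (transition c c) (at (snd c p)) w = w" if "p \<in> fst c" for p w
  proof -
    have "open (snd c ` fst c)"
      using M c unfolding complex_manifold_def by (auto simp: case_prod_beta)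
    then have "(transition c c has_derivative (\<lambda>x. x)) (at (snd c p))"
      by (rule has_derivative_transform_within_open[OF has_derivative_ident])
         (use that inj in \<open>auto simp: transition_def\<close>)
    from fun_cong[OF frechet_derivative_at[OF this], of w] show ?thesis by simp
  qed
  show ?thesis
    unfolding bij_betw_def
  proof
    show "inj_on (bundle_chart c) (Sigma (fst c) (holo_tangent_space \<A>))"
    proof (rule inj_onI, clarify)
      fix p v q w
      assume pv: "p \<in> fst c" "v \<in> holo_tangent_space \<A> p"
        and qw: "q \<in> fst c" "w \<in> holo_tangent_space \<A> q"
        and "bundle_chart c (p, v) = bundle_chart c (q, w)"
      then have pq: "p = q" and vw: "v c = w c"
        using inj by (auto simp: bundle_chart_def inj_on_def)
      have "v d = w d" for d
      proof (cases "d \<in> \<A> \<and> q \<in> fst d")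
        case True
        have "u d = frechet_derivative (transition c d) (at (snd c q)) (u c)"
          if "u \<in> holo_tangent_space \<A> q" for u
          using that True c qw(1) unfolding holo_tangent_space_def by blast
        from this[of v] this[of w] show ?thesis using pv(2) qw(2) pq vw by metis
      next
        case False
        have "u d = 0" if "u \<in> holo_tangent_space \<A> q" for u
          using that False unfolding holo_tangent_space_def by blast
        then show ?thesis using pv(2) qw(2) pq by metis
      qed
      then show "p = q \<and> v = w" using pq by auto
    qed
    show "bundle_chart c ` Sigma (fst c) (holo_tangent_space \<A>) = chart_range c"
    proof
      show "bundle_chart c ` Sigma (fst c) (holo_tangent_space \<A>) \<subseteq> chart_range c"
        by (auto simp: bundle_chart_def chart_range_def)
      show "chart_range c \<subseteq> bundle_chart c ` Sigma (fst c) (holo_tangent_space \<A>)"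
      proof
        fix x assume "x \<in> chart_range c"
        then obtain p w where p: "p \<in> fst c" and x: "x = (snd c p, w)"
          by (auto simp: chart_range_def)
        define v where "v = (\<lambda>d. if d \<in> \<A> \<and> p \<in> fst d
          then frechet_derivative (transition c d) (at (snd c p)) w else 0)"
        have "v \<in> holo_tangent_space \<A> p"
          unfolding holo_tangent_space_def mem_Collect_eq
        proof (intro conjI ballI impI allI)
          fix d e assume "d \<in> \<A>" "e \<in> \<A>" "p \<in> fst d \<and> p \<in> fst e"
          with transition_cocycle[OF M c, of d e p w] p
          show "v e = frechet_derivative (transition d e) (at (snd d p)) (v d)"
            by (simp add: v_def)
        qed (auto simp: v_def)
        moreover have "bundle_chart c (p, v) = x"
          using c p cid[OF p] by (simp add: x bundle_chart_def v_def)
        ultimately show "x \<in> bundle_chart c ` Sigma (fst c) (holo_tangent_space \<A>)"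
          using p by (intro image_eqI[of _ _ "(p, v)"]) auto
      qed
    qed
  qed
qed


section \<open>Wirtinger derivatives in the coordinates \<open>(z, \<eta>)\<close>\<close>

type_synonym 'n cfun = "(complex^'n) \<times> (complex^'n) \<Rightarrow> complex"

definition d_z :: "'n::finite \<Rightarrow> 'n cfun \<Rightarrow> 'n cfun" where
  "d_z k f x = (frechet_derivative f (at x) (axis k 1, 0)
              - \<i> * frechet_derivative f (at x) (axis k \<i>, 0)) / 2"

definition d_zbar :: "'n::finite \<Rightarrow> 'n cfun \<Rightarrow> 'n cfun" where
  "d_zbar k f x = (frechet_derivative f (at x) (axis k 1, 0)
              + \<i> * frechet_derivative f (at x) (axis k \<i>, 0)) / 2"

definition d_eta :: "'n::finite \<Rightarrow> 'n cfun \<Rightarrow> 'n cfun" where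
  "d_eta k f x = (frechet_derivative f (at x) (0, axis k 1)
              - \<i> * frechet_derivative f (at x) (0, axis k \<i>)) / 2"

definition d_etabar :: "'n::finite \<Rightarrow> 'n cfun \<Rightarrow> 'n cfun" where
  "d_etabar k f x = (frechet_derivative f (at x) (0, axis k 1)
              + \<i> * frechet_derivative f (at x) (0, axis k \<i>)) / 2"


section \<open>Local objects of a complex Finsler metric\<close>

text \<open>In this section \<open>f\<close> is the representative of \<open>F\<close> in one chart. In \<open>metric f x $ i $ j\<close> the
  second index is the barred one; in its inverse \<open>metric_inv f x $ m $ i\<close> the barred index \<open>m\<close>
  comes first.\<close>

definition L_fun :: "((complex^'n) \<times> (complex^'n) \<Rightarrow> real) \<Rightarrow> 'n::finite cfun" where
  "L_fun f x = complex_of_real ((f x)\<^sup>2)"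

definition metric ::
    "((complex^'n) \<times> (complex^'n) \<Rightarrow> real) \<Rightarrow> (complex^'n) \<times> (complex^'n) \<Rightarrow> complex^'n::finite^'n" where
  "metric f x = (\<chi> i j. d_eta i (d_etabar j (L_fun f)) x)"

definition metric_inv ::
    "((complex^'n) \<times> (complex^'n) \<Rightarrow> real) \<Rightarrow> (complex^'n) \<times> (complex^'n) \<Rightarrow> complex^'n::finite^'n" where
  "metric_inv f x = matrix_inv (metric f x)"

definition hermitian_pos_def :: "complex^'n::finite^'n \<Rightarrow> bool" where
  "hermitian_pos_def G \<longleftrightarrow> (\<forall>i j. G $ j $ i = cnj (G $ i $ j)) \<and>
     (\<forall>v. v \<noteq> 0 \<longrightarrow> 0 < Re (\<Sum>i\<in>UNIV. \<Sum>j\<in>UNIV. G $ i $ j * v $ i * cnj (v $ j)))"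

text \<open>\<open>cf_N f k j\<close> is the coefficient with upper index \<open>k\<close> and lower index \<open>j\<close>; similarly below,
  the upper index always comes first.\<close>

definition cf_N :: "((complex^'n) \<times> (complex^'n) \<Rightarrow> real) \<Rightarrow> 'n \<Rightarrow> 'n \<Rightarrow> 'n::finite cfun" where
  "cf_N f k j x = (\<Sum>m\<in>UNIV. \<Sum>l\<in>UNIV.
     metric_inv f x $ m $ k * d_z j (\<lambda>y. metric f y $ l $ m) x * snd x $ l)"

definition delta :: "((complex^'n) \<times> (complex^'n) \<Rightarrow> real) \<Rightarrow> 'n \<Rightarrow> 'n cfun \<Rightarrow> 'n::finite cfun" where
  "delta f k u x = d_z k u x - (\<Sum>j\<in>UNIV. cf_N f j k x * d_eta j u x)"

definition delta_bar :: "((complex^'n) \<times> (complex^'n) \<Rightarrow> real) \<Rightarrow> 'n \<Rightarrow> 'n cfun \<Rightarrow> 'n::finite cfun" where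
  "delta_bar f k u x = d_zbar k u x - (\<Sum>j\<in>UNIV. cnj (cf_N f j k x) * d_etabar j u x)"

definition cf_L :: "((complex^'n) \<times> (complex^'n) \<Rightarrow> real) \<Rightarrow> 'n \<Rightarrow> 'n \<Rightarrow> 'n \<Rightarrow> 'n::finite cfun" where
  "cf_L f i j k x = (\<Sum>l\<in>UNIV. metric_inv f x $ l $ i * delta f k (\<lambda>y. metric f y $ j $ l) x)"

definition cf_C :: "((complex^'n) \<times> (complex^'n) \<Rightarrow> real) \<Rightarrow> 'n \<Rightarrow> 'n \<Rightarrow> 'n \<Rightarrow> 'n::finite cfun" where
  "cf_C f i j k x = (\<Sum>l\<in>UNIV. metric_inv f x $ l $ i * d_eta k (\<lambda>y. metric f y $ j $ l) x)"

definition cf_T :: "((complex^'n) \<times> (complex^'n) \<Rightarrow> real) \<Rightarrow> 'n \<Rightarrow> 'n \<Rightarrow> 'n \<Rightarrow> 'n::finite cfun" where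
  "cf_T f i j k x = cf_L f i j k x - cf_L f i k j x"

text \<open>\<open>curv_up f i j h k\<close> has the index \<open>h\<close> barred, \<open>curv f r j h k\<close> the indices \<open>r\<close> and \<open>h\<close>.\<close>

definition curv_up ::
    "((complex^'n) \<times> (complex^'n) \<Rightarrow> real) \<Rightarrow> 'n \<Rightarrow> 'n \<Rightarrow> 'n \<Rightarrow> 'n \<Rightarrow> 'n::finite cfun" where
  "curv_up f i j h k x = - delta_bar f h (cf_L f i j k) x
     - (\<Sum>l\<in>UNIV. delta_bar f h (cf_N f l k) x * cf_C f i j l x)"

definition curv ::
    "((complex^'n) \<times> (complex^'n) \<Rightarrow> real) \<Rightarrow> 'n \<Rightarrow> 'n \<Rightarrow> 'n \<Rightarrow> 'n \<Rightarrow> 'n::finite cfun" where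
  "curv f r j h k x = (\<Sum>i\<in>UNIV. metric f x $ i $ r * curv_up f i j h k x)"

definition curv_0k00 :: "((complex^'n) \<times> (complex^'n) \<Rightarrow> real) \<Rightarrow> 'n \<Rightarrow> 'n::finite cfun" where
  "curv_0k00 f k x = (\<Sum>r\<in>UNIV. \<Sum>h\<in>UNIV. \<Sum>j\<in>UNIV.
     curv f r k h j x * cnj (snd x $ r) * cnj (snd x $ h) * snd x $ j)"

definition curv_000k :: "((complex^'n) \<times> (complex^'n) \<Rightarrow> real) \<Rightarrow> 'n \<Rightarrow> 'n::finite cfun" where
  "curv_000k f k x = (\<Sum>r\<in>UNIV. \<Sum>j\<in>UNIV. \<Sum>h\<in>UNIV.
     curv f r j h k x * cnj (snd x $ r) * snd x $ j * cnj (snd x $ h))"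

definition l_low :: "((complex^'n) \<times> (complex^'n) \<Rightarrow> real) \<Rightarrow> 'n \<Rightarrow> 'n::finite cfun" where
  "l_low f i x = 1 / complex_of_real (f x) * (\<Sum>j\<in>UNIV. metric f x $ i $ j * cnj (snd x $ j))"

text \<open>The determinant of the metric is a positive real number, so \<open>csqrt\<close> is its usual square root.\<close>

definition m_frame :: "((complex^2) \<times> (complex^2) \<Rightarrow> real) \<Rightarrow> (complex^2) \<times> (complex^2) \<Rightarrow> complex^2" where
  "m_frame f x = vector [- l_low f 2 x / csqrt (det (metric f x)),
                           l_low f 1 x / csqrt (det (metric f x))]"

definition A_inv :: "((complex^2) \<times> (complex^2) \<Rightarrow> real) \<Rightarrow> 2 cfun" where
  "A_inv f x = (\<Sum>j\<in>UNIV. \<Sum>k\<in>UNIV. \<Sum>h\<in>UNIV.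
     m_frame f x $ j * m_frame f x $ k * l_low f h x * cf_C f h k j x)"


section \<open>Complex Finsler, Kaehler and Berwald spaces\<close>

text \<open>Continuity and smoothness on the bundle are expressed in the induced bundle charts.\<close>

definition complex_finsler ::
    "'m topology \<Rightarrow> ('m, 'n::finite) chart set \<Rightarrow> ('m \<times> ('m, 'n) tvec \<Rightarrow> real) \<Rightarrow> bool" where
  "complex_finsler X \<A> F \<longleftrightarrow>
     complex_manifold X \<A> \<and>
     (\<forall>(p, v)\<in>holo_tangent_bundle X \<A>.
        0 \<le> F (p, v) \<and> (F (p, v) = 0 \<longleftrightarrow> v = (\<lambda>_. 0)) \<and>
        (\<forall>a. F (p, \<lambda>c. a *s v c) = cmod a * F (p, v))) \<and>
     (\<forall>c\<in>\<A>. continuous_on (chart_range c) (local_rep \<A> F c) \<and>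
        smooth_on (\<lambda>x. (local_rep \<A> F c x)\<^sup>2) (slit_range c) \<and>
        (\<forall>x\<in>slit_range c. hermitian_pos_def (metric (local_rep \<A> F c) x)))"

definition kaehler_finsler ::
    "'m topology \<Rightarrow> ('m, 'n::finite) chart set \<Rightarrow> ('m \<times> ('m, 'n) tvec \<Rightarrow> real) \<Rightarrow> bool" where
  "kaehler_finsler X \<A> F \<longleftrightarrow> complex_finsler X \<A> F \<and>
     (\<forall>c\<in>\<A>. \<forall>x\<in>slit_range c. \<forall>i k.
        (\<Sum>j\<in>UNIV. cf_T (local_rep \<A> F c) i j k x * snd x $ j) = 0)"

definition complex_berwald ::
    "'m topology \<Rightarrow> ('m, 'n::finite) chart set \<Rightarrow> ('m \<times> ('m, 'n) tvec \<Rightarrow> real) \<Rightarrow> bool" where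
  "complex_berwald X \<A> F \<longleftrightarrow> kaehler_finsler X \<A> F \<and>
     (\<forall>c\<in>\<A>. \<forall>i j k z \<eta> \<eta>'. (z, \<eta>) \<in> slit_range c \<longrightarrow> (z, \<eta>') \<in> slit_range c \<longrightarrow>
        cf_L (local_rep \<A> F c) i j k (z, \<eta>) = cf_L (local_rep \<A> F c) i j k (z, \<eta>'))"

end

theory Submission
  imports Defs
begin

text \<open>For a complex Berwald metric the connection coefficients depend on the base point only, and so
  does their curvature \<open>B\<^sup>i\<^sub>j\<^sub>h\<^sub>k\<close>, the derivative of \<open>L\<^sup>i\<^sub>j\<^sub>k\<close> with respect to the conjugate of
  \<open>z\<^sup>h\<close>. The hypothesis on the contracted curvatures says that the vector \<open>B\<^sup>i\<^sub>0\<^sub>0\<^sub>0\<close> (\<open>h\<close> being contracted with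
  the conjugate of \<open>\<eta>\<close>) lies in the kernel of \<open>H\<^sub>i\<^sub>k = \<partial>\<^sup>2L/\<partial>\<eta>\<^sup>i\<partial>\<eta>\<^sup>k\<close>. In dimension 2, \<open>A\<close> vanishes
  exactly where \<open>H\<close> does, and elsewhere this kernel is spanned by \<open>\<eta>\<close>. So \<open>B\<^sup>i\<^sub>0\<^sub>0\<^sub>0 = \<lambda>\<eta>\<^sup>i\<close> on an
  open set of a fibre; comparing coefficients, \<open>B\<close> is determined by a form \<open>\<lambda>\<^sub>h\<^sub>k\<close>, which is Hermitian
  because the horizontal derivatives of \<open>L\<close> vanish. The same Hermitian symmetry then makes the
  quadratic function \<open>\<phi> = \<lambda>\<^sub>h\<^sub>k \<eta>\<^sup>h\<eta>\<^sup>k\<close> (first \<open>\<eta>\<close> conjugated) satisfy \<open>L \<partial>\<^sub>h\<phi> = \<phi> \<partial>\<^sub>hL\<close>;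
  differentiating once more gives \<open>\<phi> H = 0\<close>, whence \<open>B = 0\<close>.

  This needs a point with \<open>A \<noteq> 0\<close> in every fibre. Since \<open>H\<close> is parallel along horizontal
  curves, its vanishing on a whole fibre is an open condition on the base point; so is its not vanishing
  identically, and the space is connected.\<close>

section \<open>Calculus of smooth maps\<close>

abbreviation fdv :: "'a::real_normed_vector \<Rightarrow> ('a \<Rightarrow> 'b::real_normed_vector) \<Rightarrow> 'a \<Rightarrow> 'b" where
  "fdv v f \<equiv> (\<lambda>x. frechet_derivative f (at x) v)"

lemma fdv_eqI: "(f has_derivative D) (at x) \<Longrightarrow> fdv v f x = D v"
  using frechet_derivative_at by metis

lemma fdv_has_derivative:
  "f differentiable (at x) \<Longrightarrow> (f has_derivative (\<lambda>v. fdv v f x)) (at x)"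
  by (simp add: frechet_derivative_works)

text \<open>Both functions have the same derivatives at \<open>x\<close>, so the choice behind
  \<open>frechet_derivative\<close> picks the same map for both, even at points where no derivative
  exists.\<close>

lemma fdv_cong_open:
  assumes "open S" "x \<in> S" "\<And>y. y \<in> S \<Longrightarrow> f y = g y"
  shows "fdv v f x = fdv v g x"
proof -
  have "(f has_derivative D) (at x) \<longleftrightarrow> (g has_derivative D) (at x)" for D
    using has_derivative_transform_within_open[of _ D x UNIV S] assms by (metis (full_types))
  then show ?thesis by (simp add: frechet_derivative_def)
qed

lemma differentiable_cong_open:
  assumes "open S" "x \<in> S" "\<And>y. y \<in> S \<Longrightarrow> f y = g y"
  shows "f differentiable (at x) \<longleftrightarrow> g differentiable (at x)"
proof -
  have "(f has_derivative D) (at x) \<longleftrightarrow> (g has_derivative D) (at x)" for D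
    using has_derivative_transform_within_open[of _ D x UNIV S] assms by (metis (full_types))
  then show ?thesis by (simp add: differentiable_def)
qed

lemma Ck_on_cong:
  assumes "open S" "\<And>y. y \<in> S \<Longrightarrow> f y = g y"
  shows "Ck_on k f S \<longleftrightarrow> Ck_on k g S"
  using assms(2)
proof (induction k arbitrary: f g)
  case 0
  then show ?case by (simp cong: continuous_on_cong)
next
  case (Suc k)
  have "Ck_on k (fdv v f) S \<longleftrightarrow> Ck_on k (fdv v g) S" for v
    by (rule Suc.IH) (use fdv_cong_open[OF assms(1)] Suc.prems in blast)
  moreover have "(\<forall>x\<in>S. f differentiable (at x)) \<longleftrightarrow> (\<forall>x\<in>S. g differentiable (at x))"
    using differentiable_cong_open[OF assms(1)] Suc.prems by blast
  ultimately show ?case by simp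
qed

lemma Ck_on_SucD: "Ck_on (Suc k) f S \<Longrightarrow> Ck_on k f S"
proof (induction k arbitrary: f)
  case 0
  then show ?case
    by (auto simp: continuous_at_imp_continuous_on differentiable_imp_continuous_within)
next
  case (Suc k)
  then show ?case by (metis Ck_on.simps(2))
qed

lemma smooth_on_cong:
  assumes "open S" "\<And>y. y \<in> S \<Longrightarrow> f y = g y"
  shows "smooth_on f S \<longleftrightarrow> smooth_on g S"
  unfolding smooth_on_def using Ck_on_cong[of S f g] assms by simp

lemma smooth_on_continuous: "smooth_on f S \<Longrightarrow> continuous_on S f"
  unfolding smooth_on_def by (metis Ck_on.simps(1))

lemma smooth_on_differentiable: "smooth_on f S \<Longrightarrow> x \<in> S \<Longrightarrow> f differentiable (at x)"
  unfolding smooth_on_def by (metis Ck_on.simps(2))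

lemma smooth_on_fdv: "smooth_on f S \<Longrightarrow> smooth_on (fdv v f) S"
  unfolding smooth_on_def by (metis Ck_on.simps(2))

lemma smooth_on_const [simp, intro]: "smooth_on (\<lambda>x. c) S"
proof -
  have "Ck_on k (\<lambda>x. c) S" for k
    by (induction k arbitrary: c) auto
  then show ?thesis by (simp add: smooth_on_def)
qed

lemma fdv_bounded_linear_comp:
  assumes "bounded_linear h" "f differentiable (at x)"
  shows "fdv v (\<lambda>x. h (f x)) x = h (fdv v f x)"
  by (rule fdv_eqI, rule bounded_linear.has_derivative[OF assms(1)])
     (rule fdv_has_derivative[OF assms(2)])

lemma smooth_on_bounded_linear_comp:
  assumes "bounded_linear h" "smooth_on f S" "open S"
  shows "smooth_on (\<lambda>x. h (f x)) S"
proof -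
  have "Ck_on k (\<lambda>x. h (f x)) S" if "smooth_on f S" for k
    using that
  proof (induction k arbitrary: f)
    case 0
    then show ?case
      using bounded_linear.continuous_on[OF assms(1)] smooth_on_continuous by fastforce
  next
    case (Suc k)
    have d: "\<And>x. x \<in> S \<Longrightarrow> f differentiable (at x)"
      using smooth_on_differentiable[OF Suc.prems] .
    have "Ck_on k (fdv v (\<lambda>x. h (f x))) S" for v
      using Suc.IH[OF smooth_on_fdv[OF Suc.prems, of v]]
        Ck_on_cong[OF assms(3), of "fdv v (\<lambda>x. h (f x))" "\<lambda>x. h (fdv v f x)" k]
        fdv_bounded_linear_comp[OF assms(1) d] by auto
    moreover have "(\<lambda>x. h (f x)) differentiable (at x)" if "x \<in> S" for x
      using bounded_linear.has_derivative[OF assms(1) fdv_has_derivative[OF d[OF that]]]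
      by (auto simp: differentiable_def)
    ultimately show ?case by simp
  qed
  then show ?thesis using assms(2) by (simp add: smooth_on_def)
qed

lemma smooth_on_bounded_linear:
  assumes "bounded_linear h"
  shows "smooth_on h S"
proof -
  have "fdv v h = (\<lambda>x. h v)" for v
    by (rule ext) (rule fdv_eqI[OF bounded_linear_imp_has_derivative[OF assms]])
  then have "Ck_on k h S" for k
    using smooth_on_const[of _ S] assms
    by (cases k)
       (auto simp: linear_continuous_on smooth_on_def bounded_linear_imp_differentiable
         simp del: smooth_on_const)
  then show ?thesis by (simp add: smooth_on_def)
qed

lemma Ck_on_add:
  assumes "Ck_on k f S" "Ck_on k g S" "open S"
  shows "Ck_on k (\<lambda>x. f x + g x) S"
  using assms(1,2)
proof (induction k arbitrary: f g)
  case 0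
  then show ?case by (simp add: continuous_on_add)
next
  case (Suc k)
  then have d: "\<And>x. x \<in> S \<Longrightarrow> f differentiable (at x)" "\<And>x. x \<in> S \<Longrightarrow> g differentiable (at x)"
    and c: "\<And>v. Ck_on k (fdv v f) S" "\<And>v. Ck_on k (fdv v g) S" by auto
  have "fdv v (\<lambda>x. f x + g x) x = fdv v f x + fdv v g x" if "x \<in> S" for v x
    by (rule fdv_eqI) (intro has_derivative_add fdv_has_derivative d that)
  then have "Ck_on k (fdv v (\<lambda>x. f x + g x)) S" for v
    using Suc.IH[OF c[of v]]
      Ck_on_cong[OF assms(3), of "fdv v (\<lambda>x. f x + g x)" "\<lambda>x. fdv v f x + fdv v g x" k] by simp
  then show ?case using d by simp
qed

lemma smooth_on_add:
  "smooth_on f S \<Longrightarrow> smooth_on g S \<Longrightarrow> open S \<Longrightarrow> smooth_on (\<lambda>x. f x + g x) S"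
  by (simp add: smooth_on_def Ck_on_add)

lemma Ck_on_mult:
  fixes f g :: "'a::real_normed_vector \<Rightarrow> 'b::real_normed_algebra"
  assumes "Ck_on k f S" "Ck_on k g S" "open S"
  shows "Ck_on k (\<lambda>x. f x * g x) S"
  using assms(1,2)
proof (induction k arbitrary: f g)
  case 0
  then show ?case by (simp add: continuous_on_mult)
next
  case (Suc k)
  then have d: "\<And>x. x \<in> S \<Longrightarrow> f differentiable (at x)" "\<And>x. x \<in> S \<Longrightarrow> g differentiable (at x)"
    and c: "\<And>v. Ck_on k (fdv v f) S" "\<And>v. Ck_on k (fdv v g) S" by auto
  have eq: "fdv v (\<lambda>x. f x * g x) x = f x * fdv v g x + fdv v f x * g x" if "x \<in> S" for v x
    by (rule fdv_eqI) (intro has_derivative_mult fdv_has_derivative d that)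
  have "Ck_on k (\<lambda>x. f x * fdv v g x + fdv v f x * g x) S" for v
    by (intro Ck_on_add Suc.IH c Ck_on_SucD[OF Suc.prems(1)] Ck_on_SucD[OF Suc.prems(2)] assms(3))
  then have "Ck_on k (fdv v (\<lambda>x. f x * g x)) S" for v
    using Ck_on_cong[OF assms(3), of "fdv v (\<lambda>x. f x * g x)"
        "\<lambda>x. f x * fdv v g x + fdv v f x * g x" k] eq by simp
  then show ?case using d by simp
qed

lemma smooth_on_mult:
  fixes f g :: "'a::real_normed_vector \<Rightarrow> 'b::real_normed_algebra"
  shows "smooth_on f S \<Longrightarrow> smooth_on g S \<Longrightarrow> open S \<Longrightarrow> smooth_on (\<lambda>x. f x * g x) S"
  by (simp add: smooth_on_def Ck_on_mult)

lemma smooth_on_uminus: "smooth_on f S \<Longrightarrow> open S \<Longrightarrow> smooth_on (\<lambda>x. - f x) S"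
  by (rule smooth_on_bounded_linear_comp[OF bounded_linear_minus[OF bounded_linear_ident]])

lemma smooth_on_diff:
  "smooth_on f S \<Longrightarrow> smooth_on g S \<Longrightarrow> open S \<Longrightarrow> smooth_on (\<lambda>x. f x - g x) S"
  using smooth_on_add[OF _ smooth_on_uminus] by fastforce

lemma smooth_on_sum:
  "(\<And>i. i \<in> I \<Longrightarrow> smooth_on (f i) S) \<Longrightarrow> open S \<Longrightarrow> smooth_on (\<lambda>x. \<Sum>i\<in>I. f i x) S"
  by (induction I rule: infinite_finite_induct) (auto intro!: smooth_on_add)

text \<open>The derivative is a product of \<open>inverse (f x)\<close>, a derivative of
  \<open>f\<close> and a sign, so the induction on the order closes with \<open>f\<close>
  fixed.\<close>

lemma smooth_on_inverse:
  fixes f :: "'a::real_normed_vector \<Rightarrow> 'b::real_normed_field"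
  assumes "smooth_on f S" "open S" "\<And>x. x \<in> S \<Longrightarrow> f x \<noteq> 0"
  shows "smooth_on (\<lambda>x. inverse (f x)) S"
proof -
  have "Ck_on k (\<lambda>x. inverse (f x)) S" for k
  proof (induction k)
    case 0
    then show ?case using assms by (simp add: continuous_on_inverse smooth_on_continuous)
  next
    case (Suc k)
    note d = smooth_on_differentiable[OF assms(1)]
    have "fdv v (\<lambda>x. inverse (f x)) x = - 1 * (inverse (f x) * fdv v f x * inverse (f x))"
      if "x \<in> S" for v x
      using fdv_eqI[OF Deriv.has_derivative_inverse[OF assms(3)[OF that] fdv_has_derivative[OF d[OF that]]]]
      by simp
    moreover have "Ck_on k (\<lambda>x. - 1 * (inverse (f x) * fdv v f x * inverse (f x))) S" for v
      using smooth_on_fdv[OF assms(1), of v] smooth_on_const[of "-1::'b" S]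
      unfolding smooth_on_def by (intro Ck_on_mult Suc.IH assms(2)) auto
    ultimately have "Ck_on k (fdv v (\<lambda>x. inverse (f x))) S" for v
      using Ck_on_cong[OF assms(2), of "fdv v (\<lambda>x. inverse (f x))"
          "\<lambda>x. - 1 * (inverse (f x) * fdv v f x * inverse (f x))" k] by simp
    moreover have "(\<lambda>x. inverse (f x)) differentiable (at x)" if "x \<in> S" for x
      using Deriv.has_derivative_inverse[OF assms(3)[OF that] fdv_has_derivative[OF d[OF that]]]
      by (auto simp: differentiable_def)
    ultimately show ?case by simp
  qed
  then show ?thesis by (simp add: smooth_on_def)
qed

text \<open>Schwarz's theorem from the mean value theorem: in every neighbourhood of
  \<open>x\<close> the two mixed derivatives share a value, possibly taken at different points, and
  continuity carries the equality to \<open>x\<close>.\<close>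

lemma symmetric_fdv_real:
  fixes u :: "'a::real_normed_vector \<Rightarrow> real"
  assumes "smooth_on u S" "open S" "x \<in> S"
  shows "fdv v (fdv w u) x = fdv w (fdv v u) x"
proof -
  have mvt: "\<exists>y z. norm (y - x) < e \<and> norm (z - x) < e \<and> y \<in> S \<and> z \<in> S \<and>
      fdv v (fdv w u) y = fdv w (fdv v u) z" if "e > 0" for e
  proof -
    obtain r where r: "r > 0" "ball x r \<subseteq> S" using assms(2,3) openE by blast
    \<comment> \<open>This side length keeps the parallelogram \<open>p s t\<close> within distance
      \<open>min e r\<close> of \<open>x\<close>; the summand 1 covers
      \<open>v = w = 0\<close>.\<close>
    define d where "d = min e r / (2 * (norm v + norm w + 1))"
    have nn: "norm v + norm w + 1 > 0" by (simp add: add_nonneg_pos)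
    have d0: "d > 0" using r that nn by (simp add: d_def)
    have dd: "d * (norm v + norm w) < min e r"
    proof -
      have "d * (norm v + norm w) \<le> d * (norm v + norm w + 1)" using d0 by simp
      also have "\<dots> = min e r / 2" using nn by (simp add: d_def field_simps)
      finally show ?thesis using r that by auto
    qed
    define p where "p s t = x + s *\<^sub>R v + t *\<^sub>R w" for s t
    have small: "norm (p s t - x) < min e r" if "0 \<le> s" "s \<le> d" "0 \<le> t" "t \<le> d" for s t
    proof -
      have "norm (p s t - x) \<le> s * norm v + t * norm w"
        using that norm_triangle_ineq[of "s *\<^sub>R v" "t *\<^sub>R w"] by (simp add: p_def)
      also have "\<dots> \<le> d * norm v + d * norm w"
        using that by (intro add_mono mult_right_mono) auto
      finally show ?thesis using dd by (simp add: distrib_left)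
    qed
    have pS: "p s t \<in> S" if "0 \<le> s" "s \<le> d" "0 \<le> t" "t \<le> d" for s t
      using small[OF that] r(2) by (auto simp: dist_norm norm_minus_commute)
    have ds: "((\<lambda>s. h (p s t)) has_real_derivative fdv v h (p s t)) (at s)"
      if "smooth_on h S" "p s t \<in> S" for h :: "'a \<Rightarrow> real" and s t
    proof -
      have "((\<lambda>s. p s t) has_derivative (\<lambda>a. a *\<^sub>R v)) (at s)"
        unfolding p_def by (auto intro!: derivative_eq_intros)
      from diff_chain_at[OF this fdv_has_derivative[OF smooth_on_differentiable[OF that]]]
      have "((\<lambda>s. h (p s t)) has_derivative (\<lambda>a. fdv (a *\<^sub>R v) h (p s t))) (at s)"
        by (simp add: o_def)
      moreover have "fdv (a *\<^sub>R v) h (p s t) = fdv v h (p s t) * a" for a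
        using linear_scale[OF linear_frechet_derivative[OF smooth_on_differentiable[OF that]]] by simp
      ultimately show ?thesis by (simp add: has_field_derivative_def)
    qed
    have dt: "((\<lambda>t. h (p s t)) has_real_derivative fdv w h (p s t)) (at t)"
      if "smooth_on h S" "p s t \<in> S" for h :: "'a \<Rightarrow> real" and s t
    proof -
      have "((\<lambda>t. p s t) has_derivative (\<lambda>a. a *\<^sub>R w)) (at t)"
        unfolding p_def by (auto intro!: derivative_eq_intros)
      from diff_chain_at[OF this fdv_has_derivative[OF smooth_on_differentiable[OF that]]]
      have "((\<lambda>t. h (p s t)) has_derivative (\<lambda>a. fdv (a *\<^sub>R w) h (p s t))) (at t)"
        by (simp add: o_def)
      moreover have "fdv (a *\<^sub>R w) h (p s t) = fdv w h (p s t) * a" for a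
        using linear_scale[OF linear_frechet_derivative[OF smooth_on_differentiable[OF that]]] by simp
      ultimately show ?thesis by (simp add: has_field_derivative_def)
    qed
    \<comment> \<open>The second difference of \<open>u\<close> over the parallelogram. Resolved
      first in \<open>s\<close> and then in \<open>t\<close>, it is \<open>d * d\<close> times one
      mixed derivative at \<open>p s t\<close>; resolved in the other order, it is
      \<open>d * d\<close> times the other one at \<open>p s' t'\<close>.\<close>
    define D where "D = u (p d d) - u (p d 0) - u (p 0 d) + u (p 0 0)"
    obtain s where s: "0 < s" "s < d"
      "(u (p d d) - u (p d 0)) - (u (p 0 d) - u (p 0 0)) = (d - 0) * (fdv v u (p s d) - fdv v u (p s 0))"
    proof -
      have "((\<lambda>s. u (p s d) - u (p s 0)) has_real_derivative fdv v u (p s d) - fdv v u (p s 0)) (at s)"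
        if "0 \<le> s" "s \<le> d" for s
        using that d0 by (intro DERIV_diff ds assms(1) pS) auto
      from MVT2[OF d0 this] show ?thesis using that by auto
    qed
    obtain t where t: "0 < t" "t < d"
      "fdv v u (p s d) - fdv v u (p s 0) = (d - 0) * fdv w (fdv v u) (p s t)"
    proof -
      have "((\<lambda>t. fdv v u (p s t)) has_real_derivative fdv w (fdv v u) (p s t)) (at t)"
        if "0 \<le> t" "t \<le> d" for t
        using that s by (intro dt smooth_on_fdv assms(1) pS) auto
      from MVT2[OF d0 this] show ?thesis using that by auto
    qed
    obtain t' where t': "0 < t'" "t' < d"
      "(u (p d d) - u (p 0 d)) - (u (p d 0) - u (p 0 0)) = (d - 0) * (fdv w u (p d t') - fdv w u (p 0 t'))"
    proof -
      have "((\<lambda>t. u (p d t) - u (p 0 t)) has_real_derivative fdv w u (p d t) - fdv w u (p 0 t)) (at t)"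
        if "0 \<le> t" "t \<le> d" for t
        using that d0 by (intro DERIV_diff dt assms(1) pS) auto
      from MVT2[OF d0 this] show ?thesis using that by auto
    qed
    obtain s' where s': "0 < s'" "s' < d"
      "fdv w u (p d t') - fdv w u (p 0 t') = (d - 0) * fdv v (fdv w u) (p s' t')"
    proof -
      have "((\<lambda>s. fdv w u (p s t')) has_real_derivative fdv v (fdv w u) (p s t')) (at s)"
        if "0 \<le> s" "s \<le> d" for s
        using that t' by (intro ds smooth_on_fdv assms(1) pS) auto
      from MVT2[OF d0 this] show ?thesis using that by auto
    qed
    have "d * (d * fdv w (fdv v u) (p s t)) = d * (d * fdv v (fdv w u) (p s' t'))"
      using s(3) t(3) s'(3) t'(3) by (simp add: algebra_simps)
    then have "fdv v (fdv w u) (p s' t') = fdv w (fdv v u) (p s t)" using d0 by simp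
    then show ?thesis
      by (intro exI[of _ "p s' t'"] exI[of _ "p s t"])
        (use small[of s t] small[of s' t'] pS[of s t] pS[of s' t'] s t s' t' in simp)
  qed
  have c: "continuous_on S (fdv v (fdv w u))" "continuous_on S (fdv w (fdv v u))"
    using smooth_on_continuous smooth_on_fdv assms(1) by blast+
  show ?thesis
  proof (rule ccontr)
    assume ne: "fdv v (fdv w u) x \<noteq> fdv w (fdv v u) x"
    define e where "e = dist (fdv v (fdv w u) x) (fdv w (fdv v u) x) / 2"
    have e: "e > 0" using ne by (simp add: e_def)
    obtain d1 where d1: "d1 > 0" "\<And>y. y \<in> S \<Longrightarrow> dist y x < d1 \<Longrightarrow> dist (fdv v (fdv w u) y) (fdv v (fdv w u) x) < e"
      using c(1) assms(3) e unfolding continuous_on_iff by blast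
    obtain d2 where d2: "d2 > 0" "\<And>y. y \<in> S \<Longrightarrow> dist y x < d2 \<Longrightarrow> dist (fdv w (fdv v u) y) (fdv w (fdv v u) x) < e"
      using c(2) assms(3) e unfolding continuous_on_iff by blast
    obtain y z where yz: "norm (y - x) < min d1 d2" "norm (z - x) < min d1 d2" "y \<in> S" "z \<in> S"
      "fdv v (fdv w u) y = fdv w (fdv v u) z"
      using mvt[of "min d1 d2"] d1 d2 by auto
    have "dist (fdv v (fdv w u) y) (fdv v (fdv w u) x) < e" "dist (fdv w (fdv v u) z) (fdv w (fdv v u) x) < e"
      using d1(2)[of y] d2(2)[of z] yz by (auto simp: dist_norm)
    then show False
      using dist_triangle3[of "fdv v (fdv w u) x" "fdv w (fdv v u) x" "fdv v (fdv w u) y"] yz(5)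
      unfolding e_def by (simp add: dist_commute)
  qed
qed

lemma symmetric_fdv:
  fixes u :: "'a::real_normed_vector \<Rightarrow> complex"
  assumes "smooth_on u S" "open S" "x \<in> S"
  shows "fdv v (fdv w u) x = fdv w (fdv v u) x"
proof -
  have *: "h (fdv v (fdv w u) x) = fdv v (fdv w (\<lambda>x. h (u x))) x" if h: "bounded_linear h"
    for h :: "complex \<Rightarrow> real" and v w
  proof -
    have "h (fdv v (fdv w u) x) = fdv v (\<lambda>x. h (fdv w u x)) x"
      using fdv_bounded_linear_comp[OF h smooth_on_differentiable[OF smooth_on_fdv[OF assms(1)] assms(3)]]
      by simp
    also have "\<dots> = fdv v (fdv w (\<lambda>x. h (u x))) x"
      by (rule fdv_cong_open[OF assms(2,3)])
        (use fdv_bounded_linear_comp[OF h smooth_on_differentiable[OF assms(1)]] in simp)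
    finally show ?thesis .
  qed
  have "h (fdv v (fdv w u) x) = h (fdv w (fdv v u) x)" if h: "bounded_linear h" for h :: "complex \<Rightarrow> real"
    unfolding *[OF h]
    by (rule symmetric_fdv_real[OF smooth_on_bounded_linear_comp[OF h assms(1,2)] assms(2,3)])
  then show ?thesis using bounded_linear_Re bounded_linear_Im by (simp add: complex_eq_iff)
qed

section \<open>Wirtinger operators and their calculus\<close>

definition wirt :: "complex \<Rightarrow> 'a::real_normed_vector \<Rightarrow> 'a \<Rightarrow> ('a \<Rightarrow> complex) \<Rightarrow> 'a \<Rightarrow> complex" where
  "wirt s v v' u x = (fdv v u x + s * fdv v' u x) / 2"

lemma smooth_on_wirt:
  assumes "smooth_on u S" "open S"
  shows "smooth_on (wirt s v v' u) S"
proof -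
  have "wirt s v v' u = (\<lambda>x. (1/2) * (fdv v u x + s * fdv v' u x))"
    by (auto simp: wirt_def)
  then show ?thesis
    using assms by (simp only:) (intro smooth_on_mult smooth_on_add smooth_on_fdv smooth_on_const)
qed

lemma wirt_cong_open:
  assumes "open S" "x \<in> S" "\<And>y. y \<in> S \<Longrightarrow> f y = g y"
  shows "wirt s v v' f x = wirt s v v' g x"
  unfolding wirt_def using fdv_cong_open[OF assms(1,2), of f g] assms(3) by simp

lemma wirt_const: "wirt s v v' (\<lambda>x. c) x = 0"
  by (simp add: wirt_def)

lemma wirt_add:
  assumes "f differentiable (at x)" "g differentiable (at x)"
  shows "wirt s v v' (\<lambda>y. f y + g y) x = wirt s v v' f x + wirt s v v' g x"
proof -
  have "fdv v (\<lambda>y. f y + g y) x = fdv v f x + fdv v g x" for v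
    by (rule fdv_eqI) (intro has_derivative_add fdv_has_derivative assms)
  then show ?thesis by (simp add: wirt_def algebra_simps add_divide_distrib)
qed

lemma wirt_mult:
  assumes "f differentiable (at x)" "g differentiable (at x)"
  shows "wirt s v v' (\<lambda>y. f y * g y) x = wirt s v v' f x * g x + f x * wirt s v v' g x"
proof -
  have "fdv v (\<lambda>y. f y * g y) x = f x * fdv v g x + fdv v f x * g x" for v
    by (rule fdv_eqI) (intro has_derivative_mult fdv_has_derivative assms)
  then show ?thesis by (simp add: wirt_def algebra_simps add_divide_distrib)
qed

lemma wirt_sum:
  assumes "\<And>i. i \<in> I \<Longrightarrow> f i differentiable (at x)"
  shows "wirt s v v' (\<lambda>y. \<Sum>i\<in>I. f i y) x = (\<Sum>i\<in>I. wirt s v v' (f i) x)"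
  using assms
proof (induction I rule: infinite_finite_induct)
  case (insert i I)
  then show ?case by (simp add: wirt_add differentiable_sum)
qed (simp_all add: wirt_const)

lemma wirt_commute:
  assumes "smooth_on u S" "open S" "x \<in> S"
  shows "wirt s v v' (wirt t w w' u) x = wirt t w w' (wirt s v v' u) x"
proof -
  have *: "fdv v (wirt t w w' u) x = (fdv v (fdv w u) x + t * fdv v (fdv w' u) x) / 2" for v t w w'
  proof -
    note d = fdv_has_derivative[OF smooth_on_differentiable[OF smooth_on_fdv[OF assms(1)] assms(3)]]
    show ?thesis
      unfolding wirt_def[abs_def] divide_inverse
      by (rule fdv_eqI) (intro has_derivative_mult_left has_derivative_add has_derivative_mult_right d)
  qed
  show ?thesis
    unfolding wirt_def[of s] wirt_def[of t w w' "wirt s v v' u"] *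
    using symmetric_fdv[OF assms] by (simp add: algebra_simps add_divide_distrib)
qed

text \<open>The coordinate derivatives are \<open>wirt\<close> with \<open>s = - \<i>\<close>
  (holomorphic) or \<open>s = \<i>\<close> (antiholomorphic). Hiding the parameters lets each rule
  be proved once and instantiated four times.\<close>

definition is_wirt :: "(('a::real_normed_vector \<Rightarrow> complex) \<Rightarrow> 'a \<Rightarrow> complex) \<Rightarrow> bool" where
  "is_wirt D \<longleftrightarrow> (\<exists>s v v'. D = wirt s v v')"

lemma is_wirt_coord: "is_wirt (d_z k)" "is_wirt (d_zbar k)" "is_wirt (d_eta k)" "is_wirt (d_etabar k)"
proof -
  have "d_z k = wirt (-\<i>) (axis k 1, 0) (axis k \<i>, 0)" "d_zbar k = wirt \<i> (axis k 1, 0) (axis k \<i>, 0)"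
    "d_eta k = wirt (-\<i>) (0, axis k 1) (0, axis k \<i>)" "d_etabar k = wirt \<i> (0, axis k 1) (0, axis k \<i>)"
    by (auto simp: fun_eq_iff d_z_def d_zbar_def d_eta_def d_etabar_def wirt_def)
  then show "is_wirt (d_z k)" "is_wirt (d_zbar k)" "is_wirt (d_eta k)" "is_wirt (d_etabar k)"
    unfolding is_wirt_def by blast+
qed

lemma is_wirt_smooth: "is_wirt D \<Longrightarrow> smooth_on u S \<Longrightarrow> open S \<Longrightarrow> smooth_on (D u) S"
  by (auto simp: is_wirt_def intro: smooth_on_wirt)

lemma is_wirt_cong:
  "is_wirt D \<Longrightarrow> open S \<Longrightarrow> (\<And>y. y \<in> S \<Longrightarrow> f y = g y) \<Longrightarrow> x \<in> S \<Longrightarrow> D f x = D g x"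
  by (auto simp: is_wirt_def intro: wirt_cong_open)

lemma is_wirt_commute:
  "is_wirt D \<Longrightarrow> is_wirt D' \<Longrightarrow> smooth_on u S \<Longrightarrow> open S \<Longrightarrow> x \<in> S \<Longrightarrow> D (D' u) x = D' (D u) x"
  by (auto simp: is_wirt_def intro: wirt_commute)

lemma is_wirt_const: "is_wirt D \<Longrightarrow> D (\<lambda>x. c) x = 0"
  by (auto simp: is_wirt_def intro: wirt_const)

lemma is_wirt_add:
  "is_wirt D \<Longrightarrow> smooth_on u S \<Longrightarrow> smooth_on w S \<Longrightarrow> x \<in> S \<Longrightarrow>
    D (\<lambda>y. u y + w y) x = D u x + D w x"
  by (auto simp: is_wirt_def intro: wirt_add smooth_on_differentiable)

lemma is_wirt_mult:
  "is_wirt D \<Longrightarrow> smooth_on u S \<Longrightarrow> smooth_on w S \<Longrightarrow> x \<in> S \<Longrightarrow>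
    D (\<lambda>y. u y * w y) x = D u x * w x + u x * D w x"
  by (auto simp: is_wirt_def intro: wirt_mult smooth_on_differentiable)

lemma is_wirt_uminus:
  assumes "is_wirt D" "smooth_on u S" "x \<in> S"
  shows "D (\<lambda>y. - u y) x = - D u x"
  using is_wirt_mult[OF assms(1) smooth_on_const assms(2,3), of "-1"] is_wirt_const[OF assms(1)]
  by simp

lemma is_wirt_diff:
  assumes "is_wirt D" "smooth_on u S" "smooth_on w S" "x \<in> S" "open S"
  shows "D (\<lambda>y. u y - w y) x = D u x - D w x"
  using is_wirt_add[OF assms(1,2) smooth_on_uminus[OF assms(3,5)] assms(4)]
    is_wirt_uminus[OF assms(1,3,4)] by simp

lemma is_wirt_sum:
  "is_wirt D \<Longrightarrow> (\<And>i. i \<in> I \<Longrightarrow> smooth_on (u i) S) \<Longrightarrow> x \<in> S \<Longrightarrow>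
    D (\<lambda>y. \<Sum>i\<in>I. u i y) x = (\<Sum>i\<in>I. D (u i) x)"
  by (auto simp: is_wirt_def intro: wirt_sum smooth_on_differentiable)

lemma d_cnj:
  assumes "smooth_on u S" "x \<in> S"
  shows "d_z k (\<lambda>y. cnj (u y)) x = cnj (d_zbar k u x)" "d_zbar k (\<lambda>y. cnj (u y)) x = cnj (d_z k u x)"
    "d_eta k (\<lambda>y. cnj (u y)) x = cnj (d_etabar k u x)" "d_etabar k (\<lambda>y. cnj (u y)) x = cnj (d_eta k u x)"
  using fdv_bounded_linear_comp[OF bounded_linear_cnj smooth_on_differentiable[OF assms]]
  by (simp_all add: d_z_def d_zbar_def d_eta_def d_etabar_def)

lemma bounded_linear_snd_nth: "bounded_linear (\<lambda>x::'a::real_normed_vector \<times> (complex^'n). snd x $ j)"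
  by (rule bounded_linear_compose[OF bounded_linear_vec_nth bounded_linear_snd])

lemma smooth_on_eta: "smooth_on (\<lambda>x::'a::real_normed_vector \<times> (complex^'n). snd x $ j) S"
  by (rule smooth_on_bounded_linear[OF bounded_linear_snd_nth])

lemma smooth_on_cnj: "smooth_on u S \<Longrightarrow> open S \<Longrightarrow> smooth_on (\<lambda>y. cnj (u y)) S"
  by (rule smooth_on_bounded_linear_comp[OF bounded_linear_cnj])

lemma d_eta_coord:
  fixes x :: "(complex^'n) \<times> (complex^'n::finite)"
  shows "d_z k (\<lambda>x. snd x $ j) x = 0" "d_zbar k (\<lambda>x. snd x $ j) x = 0"
  "d_eta k (\<lambda>x. snd x $ j) x = (if j = k then 1 else 0)" "d_etabar k (\<lambda>x. snd x $ j) x = 0"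
proof -
  have *: "fdv v (\<lambda>x::(complex^'n) \<times> (complex^'n). snd x $ j) x = snd v $ j" for v
    by (rule fdv_eqI[OF bounded_linear_imp_has_derivative[OF bounded_linear_snd_nth]])
  show "d_z k (\<lambda>x. snd x $ j) x = 0" "d_zbar k (\<lambda>x. snd x $ j) x = 0"
    "d_eta k (\<lambda>x. snd x $ j) x = (if j = k then 1 else 0)" "d_etabar k (\<lambda>x. snd x $ j) x = 0"
    by (simp_all add: d_z_def d_zbar_def d_eta_def d_etabar_def * axis_def)
qed

lemma vec_eq_sum_axis:
  fixes v :: "complex^'n::finite"
  shows "v = (\<Sum>k\<in>UNIV. Re (v $ k) *\<^sub>R axis k 1 + Im (v $ k) *\<^sub>R axis k \<i>)"
proof -
  have "(\<Sum>k\<in>UNIV. Re (v $ k) *\<^sub>R axis k 1 + Im (v $ k) *\<^sub>R axis k \<i>) $ i = v $ i" for i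
  proof -
    have "(\<Sum>k\<in>UNIV. Re (v $ k) *\<^sub>R axis k 1 + Im (v $ k) *\<^sub>R axis k \<i>) $ i =
        (\<Sum>k\<in>UNIV. if k = i then v $ i else 0)"
      unfolding sum_component
      by (rule sum.cong) (auto simp: axis_def complex_eq_iff)
    then show ?thesis by simp
  qed
  then show ?thesis by (simp add: vec_eq_iff)
qed

text \<open>Real linearity in the directions \<open>axis k 1\<close> and \<open>axis k \<i>\<close>,
  regrouped so that each pair of real directions becomes a Wirtinger derivative and its conjugate
  counterpart.\<close>

lemma fdv_expand:
  fixes u :: "'n::finite cfun"
  assumes "u differentiable (at x)"
  shows "fdv (v, w) u x = (\<Sum>k\<in>UNIV. v $ k * d_z k u x + cnj (v $ k) * d_zbar k u x
      + w $ k * d_eta k u x + cnj (w $ k) * d_etabar k u x)"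
proof -
  have lin: "linear (\<lambda>v. fdv v u x)" using linear_frechet_derivative[OF assms] .
  have "(v, w) = (\<Sum>k\<in>UNIV. Re (v $ k) *\<^sub>R (axis k 1, 0) + Im (v $ k) *\<^sub>R (axis k \<i>, 0)
      + Re (w $ k) *\<^sub>R (0, axis k 1) + Im (w $ k) *\<^sub>R (0, axis k \<i>))"
    by (rule prod_eqI)
      (simp_all add: fst_sum snd_sum vec_eq_sum_axis[of v, symmetric] vec_eq_sum_axis[of w, symmetric])
  then have "fdv (v, w) u x = fdv (\<Sum>k\<in>UNIV. Re (v $ k) *\<^sub>R (axis k 1, 0) + Im (v $ k) *\<^sub>R (axis k \<i>, 0)
      + Re (w $ k) *\<^sub>R (0, axis k 1) + Im (w $ k) *\<^sub>R (0, axis k \<i>)) u x"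
    by simp
  also have "\<dots> = (\<Sum>k\<in>UNIV. Re (v $ k) *\<^sub>R fdv (axis k 1, 0) u x + Im (v $ k) *\<^sub>R fdv (axis k \<i>, 0) u x
      + Re (w $ k) *\<^sub>R fdv (0, axis k 1) u x + Im (w $ k) *\<^sub>R fdv (0, axis k \<i>) u x)"
    by (simp only: linear_sum[OF lin] linear_add[OF lin] linear_scale[OF lin])
  also have "\<dots> = (\<Sum>k\<in>UNIV. v $ k * d_z k u x + cnj (v $ k) * d_zbar k u x
      + w $ k * d_eta k u x + cnj (w $ k) * d_etabar k u x)"
  proof (rule sum.cong[OF refl])
    fix k
    have *: "Re a *\<^sub>R p + Im a *\<^sub>R q = a * ((p - \<i> * q) / 2) + cnj a * ((p + \<i> * q) / 2)" for a p q :: complex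
      by (simp add: complex_eq_iff field_simps)
    show "Re (v $ k) *\<^sub>R fdv (axis k 1, 0) u x + Im (v $ k) *\<^sub>R fdv (axis k \<i>, 0) u x
      + Re (w $ k) *\<^sub>R fdv (0, axis k 1) u x + Im (w $ k) *\<^sub>R fdv (0, axis k \<i>) u x =
      v $ k * d_z k u x + cnj (v $ k) * d_zbar k u x
      + w $ k * d_eta k u x + cnj (w $ k) * d_etabar k u x"
      using *[of "v $ k" "fdv (axis k 1, 0) u x" "fdv (axis k \<i>, 0) u x"]
        *[of "w $ k" "fdv (0, axis k 1) u x" "fdv (0, axis k \<i>) u x"]
      by (simp add: d_z_def d_zbar_def d_eta_def d_etabar_def)
  qed
  finally show ?thesis .
qed

section \<open>Invertibility of positive definite Hermitian matrices\<close>

lemma matrix_inv_complex_works: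
  fixes A :: "complex^'n^'n"
  assumes "det A \<noteq> 0"
  shows "A ** matrix_inv A = mat 1" "matrix_inv A ** A = mat 1"
proof -
  have "\<exists>A'. A ** A' = mat 1 \<and> A' ** A = mat 1"
    using assms unfolding invertible_det_nz[symmetric] invertible_def .
  from someI_ex[OF this] show "A ** matrix_inv A = mat 1" "matrix_inv A ** A = mat 1"
    by (auto simp: matrix_inv_def)
qed

lemma hermitian_pos_def_det:
  fixes A :: "complex^2^2"
  assumes "hermitian_pos_def A"
  shows "det A \<noteq> 0"
proof
  assume d: "det A = 0"
  have p: "0 < Re (\<Sum>i\<in>UNIV. \<Sum>j\<in>UNIV. A $ i $ j * v $ i * cnj (v $ j))" if "v \<noteq> 0" for v
    using assms that unfolding hermitian_pos_def_def by blast
  have 1: "0 < Re (A $ 1 $ 1)"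
    using p[of "axis 1 1"] by (simp add: sum_2 axis_def vec_eq_iff forall_2)
  \<comment> \<open>In the form at this \<open>v\<close> the coefficient of
    \<open>cnj (v $ 1)\<close> cancels and that of \<open>cnj (v $ 2)\<close> is
    \<open>det A\<close>. A zero determinant would therefore make the form vanish at
    \<open>v\<close>.\<close>
  define v :: "complex^2" where "v = vector [- (A $ 2 $ 1), A $ 1 $ 1]"
  have v: "v $ 1 = - (A $ 2 $ 1)" "v $ 2 = A $ 1 $ 1" by (simp_all add: v_def)
  have "v \<noteq> 0" using 1 v by (auto simp: vec_eq_iff forall_2)
  from p[OF this] have "0 < Re (det A * cnj (v $ 2))"
    unfolding sum_2 v det_2 by (simp add: algebra_simps)
  then show False using d by simp
qed

section \<open>Finsler metrics in a chart\<close>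

text \<open>Abstracts the representative of the metric over the coordinate image \<open>Z\<close> of
  one chart, so that the local theory does not mention the manifold.\<close>

locale finsler_chart =
  fixes f :: "(complex^2) \<times> (complex^2) \<Rightarrow> real" and Z :: "(complex^2) set"
  assumes open_Z: "open Z"
    and smooth_sq: "smooth_on (\<lambda>x. (f x)\<^sup>2) (Z \<times> (UNIV - {0}))"
    and f_pos: "z \<in> Z \<Longrightarrow> \<eta> \<noteq> 0 \<Longrightarrow> 0 < f (z, \<eta>)"
    and f_scale: "z \<in> Z \<Longrightarrow> f (z, a *s \<eta>) = cmod a * f (z, \<eta>)"
    and metric_pos_def: "z \<in> Z \<Longrightarrow> \<eta> \<noteq> 0 \<Longrightarrow> hermitian_pos_def (metric f (z, \<eta>))"
begin

abbreviation S :: "((complex^2) \<times> (complex^2)) set" where "S \<equiv> Z \<times> (UNIV - {0})"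
abbreviation L :: "2 cfun" where "L \<equiv> L_fun f"
abbreviation G :: "2 \<Rightarrow> 2 \<Rightarrow> 2 cfun" where "G i j \<equiv> d_eta i (d_etabar j L)"
abbreviation H :: "2 \<Rightarrow> 2 \<Rightarrow> 2 cfun" where "H i j \<equiv> d_eta i (d_eta j L)"

lemma open_S [simp]: "open S"
  by (intro open_Times open_Z open_Diff) auto

lemma smooth_L [simp]: "smooth_on L S"
  using smooth_on_bounded_linear_comp[OF bounded_linear_of_real smooth_sq open_S]
  by (simp add: L_fun_def[abs_def])

lemmas smooth_ops [simp] =
  is_wirt_coord[THEN is_wirt_smooth, OF _ open_S] smooth_on_eta[of _ S]
  smooth_on_add[OF _ _ open_S] smooth_on_mult[OF _ _ open_S] smooth_on_uminus[OF _ open_S]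
  smooth_on_diff[OF _ _ open_S] smooth_on_sum[OF _ open_S] smooth_on_cnj[OF _ open_S]

lemmas D_add = is_wirt_coord[THEN is_wirt_add, where S = S]
lemmas D_mult = is_wirt_coord[THEN is_wirt_mult, where S = S]
lemmas D_sum = is_wirt_coord[THEN is_wirt_sum, where S = S]
lemmas D_uminus = is_wirt_coord[THEN is_wirt_uminus, where S = S]
lemmas D_diff = is_wirt_coord[THEN is_wirt_diff, where S = S, OF _ _ _ open_S]
lemmas D_const = is_wirt_coord[THEN is_wirt_const]
lemmas D_cnj = d_cnj[where S = S]
lemmas D_rules = D_add D_mult D_sum D_uminus D_diff D_const D_cnj d_eta_coord
lemmas D_cong = is_wirt_coord[THEN is_wirt_cong, OF open_S]

lemma D_commute:
  assumes "is_wirt D" "is_wirt D'" "smooth_on u S" "x \<in> S"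
  shows "D (D' u) x = D' (D u) x"
  using is_wirt_commute[OF assms(1-3) open_S assms(4)] .

section \<open>Conjugation symmetry and homogeneity of \<open>L\<close>\<close>

lemma cnj_L: "cnj (L x) = L x"
  by (simp add: L_fun_def)

lemma cnj_dL:
  assumes "x \<in> S"
  shows "cnj (d_eta i L x) = d_etabar i L x" "cnj (d_etabar i L x) = d_eta i L x"
    "cnj (d_z i L x) = d_zbar i L x" "cnj (d_zbar i L x) = d_z i L x"
  using d_cnj[OF smooth_L assms, of i] by (simp_all add: cnj_L)

lemma cnj_G:
  assumes "x \<in> S"
  shows "cnj (G i j x) = G j i x"
proof -
  have "cnj (G i j x) = d_etabar i (\<lambda>y. cnj (d_etabar j L y)) x"
    using assms by (simp add: D_cnj)
  also have "\<dots> = d_etabar i (d_eta j L) x"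
    by (rule D_cong[OF _ assms]) (simp add: cnj_dL)
  also have "\<dots> = G j i x"
    by (rule D_commute) (use assms in \<open>auto simp: is_wirt_coord\<close>)
  finally show ?thesis .
qed

text \<open>Differentiate \<open>L\<close> along the curve \<open>(1 + t * b) *s \<eta>\<close> at
  \<open>t = 0\<close>, where it equals the squared modulus of \<open>1 + t * b\<close> times its
  value at \<open>\<eta>\<close>.\<close>

lemma fdv_radial:
  assumes "x \<in> S"
  shows "fdv (0, b *s snd x) L x = of_real (2 * Re b) * L x"
proof -
  obtain z \<eta> where x: "x = (z, \<eta>)" "z \<in> Z" "\<eta> \<noteq> 0" using assms by auto
  define c where "c t = (z, (1 + of_real t * b) *s \<eta>)" for t :: real
  have "bounded_linear (\<lambda>t::real. (0::complex^2, t *\<^sub>R (b *s \<eta>)))"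
    by (intro bounded_linear_Pair bounded_linear_zero bounded_linear_scaleR_left)
  from has_derivative_add[OF has_derivative_const[of x] bounded_linear_imp_has_derivative[OF this]]
  have "((\<lambda>t. x + (0, t *\<^sub>R (b *s \<eta>))) has_derivative (\<lambda>t. (0, t *\<^sub>R (b *s \<eta>)))) (at 0)"
    by simp
  moreover have ceq: "c = (\<lambda>t. x + (0, t *\<^sub>R (b *s \<eta>)))"
    by (auto simp: fun_eq_iff c_def x vec_eq_iff algebra_simps scaleR_conv_of_real[where 'a = complex])
  ultimately have c': "(c has_derivative (\<lambda>t. (0, t *\<^sub>R (b *s \<eta>)))) (at 0)" by simp
  have c0: "c 0 = x" by (simp add: c_def x)
  have "(L has_derivative (\<lambda>v. fdv v L (c 0))) (at (c 0))"
    unfolding c0 by (rule fdv_has_derivative[OF smooth_on_differentiable[OF smooth_L assms]])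
  from diff_chain_at[OF c' this]
  have 1: "((\<lambda>t. L (c t)) has_derivative (\<lambda>t. fdv (0, t *\<^sub>R (b *s \<eta>)) L x)) (at 0)"
    by (simp add: o_def c0)
  have "L (c t) = of_real ((cmod (1 + of_real t * b))\<^sup>2) * L x" for t
    by (simp only: L_fun_def c_def f_scale[OF x(2)] x(1) power_mult_distrib of_real_mult of_real_power)
  then have Lc: "(\<lambda>t. L (c t)) = (\<lambda>t. of_real ((1 + t * Re b)\<^sup>2 + (t * Im b)\<^sup>2) * L x)"
    by (simp add: fun_eq_iff cmod_power2)
  have "((\<lambda>t. (1 + t * Re b)\<^sup>2 + (t * Im b)\<^sup>2) has_derivative (\<lambda>t. t * (2 * Re b))) (at 0)"
    by (auto intro!: derivative_eq_intros simp: algebra_simps)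
  from has_derivative_mult_left[OF has_derivative_of_real[OF this]]
  have 2: "((\<lambda>t. L (c t)) has_derivative (\<lambda>t. of_real (t * (2 * Re b)) * L x)) (at 0)"
    unfolding Lc .
  from fun_cong[OF has_derivative_unique[OF 1 2], of 1] show ?thesis by (simp add: x)
qed

text \<open>In \<open>fdv_radial\<close>, \<open>b = 1\<close> gives the sum of the holomorphic and
  the antiholomorphic contraction, and \<open>b = \<i>\<close> shows that the two are equal.\<close>

lemma euler:
  assumes "x \<in> S"
  shows "(\<Sum>i\<in>UNIV. snd x $ i * d_eta i L x) = L x"
proof -
  note e = fdv_expand[OF smooth_on_differentiable[OF smooth_L assms], of 0]
  have "(\<Sum>i\<in>UNIV. snd x $ i * d_eta i L x + cnj (snd x $ i) * d_etabar i L x) = 2 * L x"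
    using e[of "snd x"] fdv_radial[OF assms, of 1] by simp
  moreover have "\<i> * (\<Sum>i\<in>UNIV. snd x $ i * d_eta i L x - cnj (snd x $ i) * d_etabar i L x) = 0"
    using e[of "\<i> *s snd x"] fdv_radial[OF assms, of \<i>]
    by (simp add: sum_distrib_left algebra_simps)
  then have "(\<Sum>i\<in>UNIV. snd x $ i * d_eta i L x - cnj (snd x $ i) * d_etabar i L x) = 0"
    by simp
  ultimately show ?thesis by (simp add: sum.distrib sum_subtractf flip: mult_2)
qed

lemma euler_bar:
  assumes "x \<in> S"
  shows "(\<Sum>i\<in>UNIV. cnj (snd x $ i) * d_etabar i L x) = L x"
  using arg_cong[OF euler[OF assms], of cnj] assms by (simp add: cnj_dL cnj_L)

text \<open>This and the following contraction identities arise from \<open>euler\<close> by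
  repeated differentiation or conjugation; smoothness permits exchanging derivatives.\<close>

lemma eta_G:
  assumes "x \<in> S"
  shows "(\<Sum>i\<in>UNIV. snd x $ i * G i j x) = d_etabar j L x"
proof -
  have "d_etabar j (\<lambda>x. \<Sum>i\<in>UNIV. snd x $ i * d_eta i L x) x = d_etabar j L x"
    by (rule D_cong[OF euler assms])
  moreover have "d_etabar j (d_eta i L) x = G i j x" for i
    by (rule D_commute) (use assms in \<open>auto simp: is_wirt_coord\<close>)
  ultimately show ?thesis using assms by (simp add: D_rules)
qed

lemma etabar_G:
  assumes "x \<in> S"
  shows "(\<Sum>j\<in>UNIV. cnj (snd x $ j) * G i j x) = d_eta i L x"
  using arg_cong[OF eta_G[OF assms, of i], of cnj] assms by (simp add: cnj_dL cnj_G)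

lemma etabar_dG:
  assumes "x \<in> S"
  shows "(\<Sum>j\<in>UNIV. cnj (snd x $ j) * d_eta m (G i j) x) = H m i x"
proof -
  have "d_eta m (\<lambda>x. \<Sum>j\<in>UNIV. cnj (snd x $ j) * G i j x) x = H m i x"
    by (rule D_cong[OF etabar_G assms])
  then show ?thesis using assms by (simp add: D_rules)
qed

text \<open>Differentiate \<open>eta_G\<close>: the term in which the derivative falls on
  \<open>\<eta>\<close> already equals the right-hand side, so the rest vanishes.\<close>

lemma eta_dG:
  assumes "x \<in> S"
  shows "(\<Sum>i\<in>UNIV. snd x $ i * d_eta m (G i j) x) = 0"
proof -
  have "d_eta m (\<lambda>x. \<Sum>i\<in>UNIV. snd x $ i * G i j x) x = G m j x"
    by (rule D_cong[OF eta_G assms])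
  moreover have "(\<Sum>i\<in>UNIV. (if i = m then 1 else 0) * G i j x) = G m j x"
    by (simp add: if_distrib[of "\<lambda>a. a * _"] cong: if_cong)
  ultimately show ?thesis using assms by (simp add: D_rules sum.distrib)
qed

lemma H_sym: "x \<in> S \<Longrightarrow> H i j x = H j i x"
  by (rule D_commute) (auto simp: is_wirt_coord)

lemma eta_H:
  assumes "x \<in> S"
  shows "(\<Sum>i\<in>UNIV. snd x $ i * H i k x) = 0"
proof -
  have "d_eta k (\<lambda>x. \<Sum>i\<in>UNIV. snd x $ i * d_eta i L x) x = d_eta k L x"
    by (rule D_cong[OF euler assms])
  moreover have "(\<Sum>i\<in>UNIV. (if i = k then 1 else 0) * d_eta i L x) = d_eta k L x"
    by (simp add: if_distrib[of "\<lambda>a. a * _"] cong: if_cong)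
  ultimately have "(\<Sum>i\<in>UNIV. snd x $ i * H k i x) = 0"
    using assms by (simp add: D_rules sum.distrib)
  then show ?thesis using H_sym[OF assms] by simp
qed

lemma f_nonzero: "x \<in> S \<Longrightarrow> f x \<noteq> 0"
  using f_pos[of "fst x" "snd x"] by auto

lemma L_nonzero: "x \<in> S \<Longrightarrow> L x \<noteq> 0"
  using f_nonzero by (simp add: L_fun_def)

section \<open>The inverse metric and the Chern-Finsler coefficients\<close>

lemma metric_nth [simp]: "metric f x $ i $ j = G i j x"
  by (simp add: metric_def)

lemma det_metric_nonzero: "x \<in> S \<Longrightarrow> det (metric f x) \<noteq> 0"
  using hermitian_pos_def_det metric_pos_def by auto

lemma metric_inv_metric:
  assumes "x \<in> S"
  shows "(\<Sum>i\<in>UNIV. metric_inv f x $ m $ i * G i s x) = (if m = s then 1 else 0)"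
    "(\<Sum>s\<in>UNIV. G i s x * metric_inv f x $ s $ k) = (if i = k then 1 else 0)"
  using matrix_inv_complex_works[OF det_metric_nonzero[OF assms]]
  unfolding metric_inv_def[symmetric]
  by (simp_all add: matrix_matrix_mult_def mat_def vec_eq_iff)

lemma G_cancel:
  assumes "x \<in> S" "\<And>s. (\<Sum>i\<in>UNIV. G i s x * a i) = (\<Sum>i\<in>UNIV. G i s x * b i)"
  shows "a k = b k"
proof -
  have *: "(\<Sum>s\<in>UNIV. (\<Sum>i\<in>UNIV. G i s x * a i) * metric_inv f x $ s $ k) = a k" for a
  proof -
    have "(\<Sum>s\<in>UNIV. (\<Sum>i\<in>UNIV. G i s x * a i) * metric_inv f x $ s $ k) =
        (\<Sum>i\<in>UNIV. a i * (\<Sum>s\<in>UNIV. G i s x * metric_inv f x $ s $ k))"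
      by (simp add: sum_2 algebra_simps)
    also have "\<dots> = (\<Sum>i\<in>UNIV. if i = k then a k else 0)"
      unfolding metric_inv_metric[OF assms(1)] by (rule sum.cong) auto
    finally show ?thesis by simp
  qed
  show ?thesis using *[of a] *[of b] assms(2) by simp
qed

lemma G_raise:
  assumes "x \<in> S"
  shows "(\<Sum>i\<in>UNIV. G i s x * (\<Sum>m\<in>UNIV. metric_inv f x $ m $ i * a m)) = a s"
proof -
  have "(\<Sum>i\<in>UNIV. G i s x * (\<Sum>m\<in>UNIV. metric_inv f x $ m $ i * a m)) =
      (\<Sum>m\<in>UNIV. a m * (\<Sum>i\<in>UNIV. metric_inv f x $ m $ i * G i s x))"
    by (simp add: sum_2 algebra_simps)
  also have "\<dots> = (\<Sum>m\<in>UNIV. if m = s then a s else 0)"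
    unfolding metric_inv_metric[OF assms(1)] by (rule sum.cong) auto
  finally show ?thesis by simp
qed

text \<open>Lowering the upper index of \<open>cf_N\<close> undoes the inverse metric in its
  definition, and \<open>eta_G\<close> differentiated in \<open>z\<close> evaluates what
  remains.\<close>

lemma G_N:
  assumes "x \<in> S"
  shows "(\<Sum>k\<in>UNIV. G k s x * cf_N f k j x) = d_z j (d_etabar s L) x"
proof -
  have "cf_N f k j x = (\<Sum>m\<in>UNIV. metric_inv f x $ m $ k * (\<Sum>l\<in>UNIV. d_z j (G l m) x * snd x $ l))" for k
    by (simp add: cf_N_def sum_distrib_left mult.assoc)
  then have "(\<Sum>k\<in>UNIV. G k s x * cf_N f k j x) = (\<Sum>l\<in>UNIV. d_z j (G l s) x * snd x $ l)"
    using G_raise[OF assms] by simp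
  moreover have "d_z j (\<lambda>x. \<Sum>l\<in>UNIV. snd x $ l * G l s x) x = d_z j (d_etabar s L) x"
    by (rule D_cong[OF eta_G assms])
  ultimately show ?thesis using assms by (simp add: D_rules mult.commute)
qed

text \<open>Contracting \<open>G_N\<close> with the conjugate of \<open>\<eta>\<close> turns both
  sides into first derivatives of \<open>L\<close>. The result says that the horizontal derivative
  \<open>delta f j L\<close> vanishes.\<close>

lemma dL_N:
  assumes "x \<in> S"
  shows "(\<Sum>k\<in>UNIV. d_eta k L x * cf_N f k j x) = d_z j L x"
proof -
  have "d_z j (\<lambda>x. \<Sum>i\<in>UNIV. cnj (snd x $ i) * d_etabar i L x) x = d_z j L x"
    by (rule D_cong[OF euler_bar assms])
  then have "d_z j L x = (\<Sum>s\<in>UNIV. cnj (snd x $ s) * d_z j (d_etabar s L) x)"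
    using assms by (simp add: D_rules)
  also have "\<dots> = (\<Sum>k\<in>UNIV. (\<Sum>s\<in>UNIV. cnj (snd x $ s) * G k s x) * cf_N f k j x)"
    unfolding G_N[OF assms, symmetric] by (simp add: sum_2 algebra_simps)
  finally show ?thesis using etabar_G[OF assms] by simp
qed

lemma G_cf_L:
  assumes "x \<in> S"
  shows "(\<Sum>i\<in>UNIV. G i s x * cf_L f i j k x) = delta f k (G j s) x"
  using G_raise[OF assms] by (simp add: cf_L_def)

lemma G_cf_C:
  assumes "x \<in> S"
  shows "(\<Sum>i\<in>UNIV. G i s x * cf_C f i j k x) = d_eta k (G j s) x"
  using G_raise[OF assms] by (simp add: cf_C_def)

text \<open>With the index lowered, the vertical part of \<open>delta\<close> drops out by
  \<open>eta_dG\<close>, and the remaining \<open>z\<close>-derivative is the one in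
  \<open>G_N\<close>.\<close>

lemma cf_L_eta:
  assumes "x \<in> S"
  shows "(\<Sum>j\<in>UNIV. cf_L f i j k x * snd x $ j) = cf_N f i k x"
proof (rule G_cancel[OF assms, where a = "\<lambda>i. \<Sum>j\<in>UNIV. cf_L f i j k x * snd x $ j" and b = "\<lambda>i. cf_N f i k x"])
  fix s
  have "(\<Sum>i\<in>UNIV. G i s x * (\<Sum>j\<in>UNIV. cf_L f i j k x * snd x $ j)) =
      (\<Sum>j\<in>UNIV. delta f k (G j s) x * snd x $ j)"
    unfolding G_cf_L[OF assms, symmetric] by (simp add: sum_2 algebra_simps)
  also have "\<dots> = (\<Sum>l\<in>UNIV. d_z k (G l s) x * snd x $ l)
      - (\<Sum>m\<in>UNIV. cf_N f m k x * (\<Sum>j\<in>UNIV. snd x $ j * d_eta m (G j s) x))"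
    by (simp add: delta_def sum_2 algebra_simps)
  also have "\<dots> = (\<Sum>l\<in>UNIV. d_z k (G l s) x * snd x $ l)"
    by (simp add: eta_dG[OF assms])
  also have "\<dots> = d_z k (d_etabar s L) x"
  proof -
    have "d_z k (\<lambda>x. \<Sum>l\<in>UNIV. snd x $ l * G l s x) x = d_z k (d_etabar s L) x"
      by (rule D_cong[OF eta_G assms])
    then show ?thesis using assms by (simp add: D_rules mult.commute)
  qed
  finally show "(\<Sum>i\<in>UNIV. G i s x * (\<Sum>j\<in>UNIV. cf_L f i j k x * snd x $ j)) =
      (\<Sum>i\<in>UNIV. G i s x * cf_N f i k x)"
    by (simp add: G_N[OF assms])
qed

text \<open>Cramer's rule: the entries are entries of the metric, up to sign, divided by the
  nonvanishing determinant.\<close>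

lemma smooth_metric_inv [simp]: "smooth_on (\<lambda>x. metric_inv f x $ m $ k) S"
proof -
  define d where "d x = inverse (G 1 1 x * G 2 2 x - G 1 2 x * G 2 1 x)" for x
  have nz: "G 1 1 x * G 2 2 x - G 1 2 x * G 2 1 x \<noteq> 0" if "x \<in> S" for x
    using det_metric_nonzero[OF that] by (simp add: det_2)
  have d: "smooth_on d S"
    unfolding d_def by (rule smooth_on_inverse[OF _ open_S nz]) auto
  have *: "metric_inv f x $ m $ 1 = (if m = 1 then G 2 2 x else - G 2 1 x) * d x"
    "metric_inv f x $ m $ 2 = (if m = 1 then - G 1 2 x else G 1 1 x) * d x" if "x \<in> S" for x m
  proof -
    let ?a = "metric_inv f x $ m $ 1" and ?b = "metric_inv f x $ m $ 2"
      and ?D = "G 1 1 x * G 2 2 x - G 1 2 x * G 2 1 x"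
    have e: "?a * G 1 1 x + ?b * G 2 1 x = (if m = 1 then 1 else 0)"
      "?a * G 1 2 x + ?b * G 2 2 x = (if m = 2 then 1 else 0)"
      using metric_inv_metric(1)[OF that, of m 1] metric_inv_metric(1)[OF that, of m 2]
      by (simp_all add: sum_2)
    have "?a * ?D = (?a * G 1 1 x + ?b * G 2 1 x) * G 2 2 x - (?a * G 1 2 x + ?b * G 2 2 x) * G 2 1 x"
      "?b * ?D = (?a * G 1 2 x + ?b * G 2 2 x) * G 1 1 x - (?a * G 1 1 x + ?b * G 2 1 x) * G 1 2 x"
      by (simp_all add: algebra_simps)
    then show "?a = (if m = 1 then G 2 2 x else - G 2 1 x) * d x"
      "?b = (if m = 1 then - G 1 2 x else G 1 1 x) * d x"
      unfolding e d_def using nz[OF that] exhaust_2[of m] by (auto simp: field_simps)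
  qed
  have "smooth_on (\<lambda>x. metric_inv f x $ m $ 1) S"
    by (subst smooth_on_cong[OF open_S *(1)]) (use d in \<open>cases "m = 1"; simp\<close>)+
  moreover have "smooth_on (\<lambda>x. metric_inv f x $ m $ 2) S"
    by (subst smooth_on_cong[OF open_S *(2)]) (use d in \<open>cases "m = 1"; simp\<close>)+
  ultimately show ?thesis using exhaust_2[of k] by auto
qed

lemma smooth_cf_N [simp]: "smooth_on (cf_N f k j) S"
  unfolding cf_N_def[abs_def] by simp

lemma smooth_cf_L [simp]: "smooth_on (cf_L f i j k) S"
  unfolding cf_L_def[abs_def] delta_def[abs_def] by simp

section \<open>The invariant \<open>A\<close> in terms of \<open>H\<close>\<close>

text \<open>By \<open>etabar_dG\<close> the contraction of \<open>l_low\<close> with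
  \<open>cf_C\<close> is \<open>H\<close> divided by \<open>f\<close>. So \<open>A\<close> is, up to
  the factor \<open>1 / f\<close>, the form \<open>H\<close> evaluated on the frame vector
  \<open>m\<close>.\<close>

lemma A_inv_eq:
  assumes "x \<in> S"
  shows "A_inv f x = ((d_eta 2 L x)\<^sup>2 * H 1 1 x - 2 * d_eta 1 L x * d_eta 2 L x * H 1 2 x
      + (d_eta 1 L x)\<^sup>2 * H 2 2 x) / (of_real (f x) ^ 3 * det (metric f x))"
proof -
  define q where "q = csqrt (det (metric f x))"
  have q2: "q * q = det (metric f x)" by (simp add: q_def flip: power2_eq_square)
  note f0 = f_nonzero[OF assms]
  have q0: "q \<noteq> 0" using q2 det_metric_nonzero[OF assms] by auto
  have l: "l_low f i x = d_eta i L x / of_real (f x)" for i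
    using etabar_G[OF assms, of i] by (simp add: l_low_def mult.commute)
  have m: "m_frame f x $ 1 = - (d_eta 2 L x / of_real (f x) / q)"
    "m_frame f x $ 2 = d_eta 1 L x / of_real (f x) / q"
    by (simp_all add: m_frame_def l q_def)
  have C: "(\<Sum>h\<in>UNIV. l_low f h x * cf_C f h k j x) = H j k x / of_real (f x)" for j k
  proof -
    have "(\<Sum>h\<in>UNIV. d_eta h L x * cf_C f h k j x) =
        (\<Sum>s\<in>UNIV. cnj (snd x $ s) * (\<Sum>h\<in>UNIV. G h s x * cf_C f h k j x))"
      unfolding etabar_G[OF assms, symmetric] by (simp add: sum_2 algebra_simps)
    also have "\<dots> = H j k x" unfolding G_cf_C[OF assms] by (rule etabar_dG[OF assms])
    finally show ?thesis by (simp add: l flip: sum_divide_distrib)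
  qed
  have "A_inv f x = (\<Sum>j\<in>UNIV. \<Sum>k\<in>UNIV. m_frame f x $ j * m_frame f x $ k * (H j k x / of_real (f x)))"
    unfolding A_inv_def C[symmetric] by (simp add: sum_distrib_left mult.assoc)
  also have "\<dots> = ((d_eta 2 L x)\<^sup>2 * H 1 1 x - 2 * d_eta 1 L x * d_eta 2 L x * H 1 2 x
      + (d_eta 1 L x)\<^sup>2 * H 2 2 x) / (of_real (f x) ^ 3 * (q * q))"
    unfolding sum_2 m H_sym[OF assms, of 2 1] using f0 q0
    by (simp add: field_simps power2_eq_square power3_eq_cube)
  finally show ?thesis by (simp add: q2)
qed

text \<open>The symmetric form \<open>H\<close> has \<open>\<eta>\<close> in its kernel by
  \<open>eta_H\<close>, so in dimension 2 its value on one vector independent of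
  \<open>\<eta>\<close> determines it. The vector \<open>m\<close> is independent, as the covector
  \<open>d_eta i L x\<close> kills \<open>m\<close> but takes the value \<open>L x\<close> on
  \<open>\<eta>\<close>.\<close>

lemma A_inv_eq_0_iff:
  assumes "x \<in> S"
  shows "A_inv f x = 0 \<longleftrightarrow> (\<forall>i j. H i j x = 0)"
proof
  assume "\<forall>i j. H i j x = 0"
  then show "A_inv f x = 0" by (simp add: A_inv_eq[OF assms])
next
  define a b where "a = snd x $ 1" and "b = snd x $ 2"
  assume A: "A_inv f x = 0"
  note f0 = f_nonzero[OF assms]
  have n: "(d_eta 2 L x)\<^sup>2 * H 1 1 x - 2 * d_eta 1 L x * d_eta 2 L x * H 1 2 x
      + (d_eta 1 L x)\<^sup>2 * H 2 2 x = 0"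
    using A det_metric_nonzero[OF assms] f0 by (simp add: A_inv_eq[OF assms])
  have h: "a * H 1 1 x + b * H 1 2 x = 0" "a * H 1 2 x + b * H 2 2 x = 0"
    using eta_H[OF assms, of 1] eta_H[OF assms, of 2] H_sym[OF assms, of 2 1]
    by (simp_all add: sum_2 a_def b_def)
  have e: "a * d_eta 1 L x + b * d_eta 2 L x = L x"
    using euler[OF assms] by (simp add: sum_2 a_def b_def)
  have ab: "a \<noteq> 0 \<or> b \<noteq> 0" using assms by (auto simp: a_def b_def vec_eq_iff forall_2)
  \<comment> \<open>\<open>L x\<close> times the first basis vector is \<open>d_eta 1 L x\<close>
    times \<open>\<eta>\<close> plus \<open>b\<close> times
    \<open>(d_eta 2 L x, - d_eta 1 L x)\<close>. Since \<open>\<eta>\<close> is in the kernel of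
    \<open>H\<close>, only the square of the second part survives; the other basis vector is treated
    alike with \<open>- a\<close>.\<close>
  have "(L x)\<^sup>2 * H 1 1 x = b\<^sup>2 * ((d_eta 2 L x)\<^sup>2 * H 1 1 x - 2 * d_eta 1 L x * d_eta 2 L x * H 1 2 x
      + (d_eta 1 L x)\<^sup>2 * H 2 2 x)"
    unfolding e[symmetric] using h by algebra
  moreover have "(L x)\<^sup>2 * H 2 2 x = a\<^sup>2 * ((d_eta 2 L x)\<^sup>2 * H 1 1 x - 2 * d_eta 1 L x * d_eta 2 L x * H 1 2 x
      + (d_eta 1 L x)\<^sup>2 * H 2 2 x)"
    unfolding e[symmetric] using h by algebra
  ultimately have "H 1 1 x = 0" "H 2 2 x = 0" using n L_nonzero[OF assms] by auto
  then show "\<forall>i j. H i j x = 0"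
    using h ab H_sym[OF assms, of 2 1] by (auto simp: forall_2)
qed

end

section \<open>Berwald metrics in a chart\<close>

text \<open>Stated, like the next lemma, for arbitrary coefficients, so that it is a polynomial
  identity. The right-hand side groups the sums that the homogeneity identities evaluate.\<close>

lemma contract_barred:
  fixes g :: "2 \<Rightarrow> 2 \<Rightarrow> complex" and b d :: "2 \<Rightarrow> 2 \<Rightarrow> 2 \<Rightarrow> complex" and v :: "2 \<Rightarrow> 2 \<Rightarrow> complex"
  shows "(\<Sum>r\<in>UNIV. \<Sum>j\<in>UNIV. \<Sum>h\<in>UNIV.
      (- (\<Sum>i\<in>UNIV. g i r * b i j h) - (\<Sum>l\<in>UNIV. v l h * d l j r)) * c r * e j * c h) =
    - (\<Sum>h\<in>UNIV. c h * (\<Sum>i\<in>UNIV. (\<Sum>r\<in>UNIV. c r * g i r) * (\<Sum>j\<in>UNIV. b i j h * e j)))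
    - (\<Sum>h\<in>UNIV. \<Sum>r\<in>UNIV. \<Sum>l\<in>UNIV. c h * c r * v l h * (\<Sum>j\<in>UNIV. e j * d l j r))"
  unfolding sum_2 by algebra

lemma contract_unbarred:
  fixes g d :: "2 \<Rightarrow> 2 \<Rightarrow> complex" and b v :: "2 \<Rightarrow> 2 \<Rightarrow> 2 \<Rightarrow> complex"
  shows "(\<Sum>r\<in>UNIV. \<Sum>h\<in>UNIV. \<Sum>j\<in>UNIV.
      (- (\<Sum>i\<in>UNIV. g i r * b i h j) - (\<Sum>l\<in>UNIV. v l h j * d l r)) * c r * c h * e j) =
    - (\<Sum>h\<in>UNIV. c h * (\<Sum>i\<in>UNIV. (\<Sum>r\<in>UNIV. c r * g i r) * (\<Sum>j\<in>UNIV. b i h j * e j)))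
    - (\<Sum>l\<in>UNIV. (\<Sum>h\<in>UNIV. \<Sum>j\<in>UNIV. c h * e j * v l h j) * (\<Sum>r\<in>UNIV. c r * d l r))"
  unfolding sum_2 by algebra

locale berwald_chart = finsler_chart +
  assumes kaehler: "x \<in> S \<Longrightarrow> (\<Sum>j\<in>UNIV. cf_T f i j k x * snd x $ j) = 0"
    and berwald: "(z, \<eta>) \<in> S \<Longrightarrow> (z, \<eta>') \<in> S \<Longrightarrow> cf_L f i j k (z, \<eta>) = cf_L f i j k (z, \<eta>')"
begin

text \<open>Near the point, \<open>cf_L\<close> agrees with its composite with the map that resets
  the fibre coordinate to \<open>\<eta>'\<close>; the chain rule gives the rest.\<close>

lemma fdv_cf_L:
  assumes "(z, \<eta>) \<in> S" "(z, \<eta>') \<in> S"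
  shows "fdv (v, w) (cf_L f i j k) (z, \<eta>) = fdv (v, 0 :: complex^2) (cf_L f i j k) (z, \<eta>')"
proof -
  have c: "((\<lambda>x. (fst x, \<eta>')) has_derivative (\<lambda>h. (fst h, 0))) (at (z, \<eta>))"
    by (auto intro!: derivative_eq_intros)
  have "(cf_L f i j k has_derivative (\<lambda>v. fdv v (cf_L f i j k) (z, \<eta>')))
      (at ((\<lambda>x. (fst x, \<eta>')) (z, \<eta>)))"
    using fdv_has_derivative[OF smooth_on_differentiable[OF smooth_cf_L assms(2)]] by simp
  from diff_chain_at[OF c this]
  have "((\<lambda>x. cf_L f i j k (fst x, \<eta>')) has_derivative (\<lambda>v. fdv (fst v, 0) (cf_L f i j k) (z, \<eta>')))
      (at (z, \<eta>))"
    by (simp add: o_def)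
  then have "(cf_L f i j k has_derivative (\<lambda>v. fdv (fst v, 0) (cf_L f i j k) (z, \<eta>'))) (at (z, \<eta>))"
  proof (rule has_derivative_transform_within_open[OF _ open_S assms(1)])
    fix y assume "y \<in> S"
    with assms(2) show "cf_L f i j k (fst y, \<eta>') = cf_L f i j k y"
      using berwald[of "fst y" \<eta>' "snd y"] by auto
  qed
  from fdv_eqI[OF this, of "(v, w)"] show ?thesis by simp
qed

section \<open>The curvature \<open>B\<close> and functions constant along fibres\<close>

abbreviation B :: "2 \<Rightarrow> 2 \<Rightarrow> 2 \<Rightarrow> 2 \<Rightarrow> 2 cfun" where
  "B i j h k \<equiv> d_zbar h (cf_L f i j k)"

text \<open>Phrased through derivatives because such functions serve as coefficients of polynomials
  in \<open>\<eta>\<close> and its conjugate that are differentiated along the fibre.\<close>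

definition fibre_const :: "2 cfun \<Rightarrow> bool" where
  "fibre_const u \<longleftrightarrow> smooth_on u S \<and> (\<forall>x\<in>S. \<forall>m. d_eta m u x = 0 \<and> d_etabar m u x = 0)"

lemma fibre_const_smooth: "fibre_const u \<Longrightarrow> smooth_on u S"
  and fibre_const_d: "fibre_const u \<Longrightarrow> x \<in> S \<Longrightarrow> d_eta m u x = 0"
    "fibre_const u \<Longrightarrow> x \<in> S \<Longrightarrow> d_etabar m u x = 0"
  by (auto simp: fibre_const_def)

lemma fibre_const_cnj: "fibre_const u \<Longrightarrow> fibre_const (\<lambda>x. cnj (u x))"
  by (auto simp: fibre_const_def D_cnj)

lemma fibre_const_diff: "fibre_const u \<Longrightarrow> fibre_const w \<Longrightarrow> fibre_const (\<lambda>x. u x - w x)"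
  by (auto simp: fibre_const_def D_diff)

lemma fibre_const_cmult: "fibre_const u \<Longrightarrow> fibre_const (\<lambda>x. c * u x)"
  by (auto simp: fibre_const_def D_mult D_const)

lemma fibre_const_cf_L: "fibre_const (cf_L f i j k)"
proof -
  have z: "fdv (0, w) (cf_L f i j k) x = 0" if "x \<in> S" for x w
  proof -
    have "fdv (0, w) (cf_L f i j k) x = fdv 0 (cf_L f i j k) x"
      using fdv_cf_L[of "fst x" "snd x" "snd x" i j k 0 w] that
      unfolding prod.collapse zero_prod_def[symmetric] by blast
    also have "\<dots> = 0"
      by (rule linear_0[OF linear_frechet_derivative[OF smooth_on_differentiable[OF smooth_cf_L that]]])
    finally show ?thesis .
  qed
  then show ?thesis by (simp add: fibre_const_def d_eta_def d_etabar_def)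
qed

lemma fibre_const_B: "fibre_const (B i j h k)"
proof -
  have "d_eta m (B i j h k) x = d_zbar h (d_eta m (cf_L f i j k)) x"
    "d_etabar m (B i j h k) x = d_zbar h (d_etabar m (cf_L f i j k)) x" if "x \<in> S" for m x
    using that by (auto intro!: D_commute is_wirt_coord)
  moreover have "d_zbar h (d_eta m (cf_L f i j k)) x = d_zbar h (\<lambda>x. 0) x" if "x \<in> S" for m x
    by (rule D_cong(2)[OF fibre_const_d(1)[OF fibre_const_cf_L] that])
  moreover have "d_zbar h (d_etabar m (cf_L f i j k)) x = d_zbar h (\<lambda>x. 0) x" if "x \<in> S" for m x
    by (rule D_cong(2)[OF fibre_const_d(2)[OF fibre_const_cf_L] that])
  ultimately show ?thesis by (simp add: fibre_const_def D_const)
qed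

lemmas fibre_const_simps [simp] = fibre_const_B fibre_const_cf_L
  fibre_const_d[OF fibre_const_B] fibre_const_d[OF fibre_const_cf_L]

lemma B_fibre:
  assumes "(z, \<eta>) \<in> S" "(z, \<eta>') \<in> S"
  shows "B i j h k (z, \<eta>) = B i j h k (z, \<eta>')"
  using fdv_cf_L[OF assms, of i j k _ 0] by (simp add: d_zbar_def)

text \<open>The torsion does not depend on \<open>\<eta>\<close>, so the contracted Kaehler
  condition may be evaluated at the coordinate vector \<open>axis j 1\<close>, where it isolates a
  single component.\<close>

lemma cf_L_sym:
  assumes "x \<in> S"
  shows "cf_L f i j k x = cf_L f i k j x"
proof -
  let ?e = "(fst x, axis j 1 :: complex^2)"
  have e: "?e \<in> S" using assms by (auto simp: axis_eq_0_iff)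
  have "(\<Sum>l\<in>UNIV. cf_T f i l k ?e * snd ?e $ l) = (\<Sum>l\<in>UNIV. if l = j then cf_T f i j k ?e else 0)"
    by (rule sum.cong) (auto simp: axis_def)
  then have "cf_T f i j k ?e = 0" using kaehler[OF e, of i k] by simp
  then show ?thesis
    using berwald[of "fst x" "snd x" "axis j 1"] assms e by (simp add: cf_T_def)
qed

lemma B_sym: "x \<in> S \<Longrightarrow> B i j h k x = B i k h j x"
  by (rule D_cong[OF cf_L_sym])

text \<open>By \<open>cf_L_eta\<close>, \<open>cf_N\<close> is linear in \<open>\<eta>\<close> with
  fibre-constant coefficients.\<close>

lemma d_cf_N:
  assumes "x \<in> S"
  shows "d_eta m (cf_N f i k) x = cf_L f i m k x" "d_etabar m (cf_N f i k) x = 0"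
    "d_zbar h (cf_N f i k) x = (\<Sum>j\<in>UNIV. B i j h k x * snd x $ j)"
proof -
  have c: "D (cf_N f i k) x = D (\<lambda>x. \<Sum>j\<in>UNIV. cf_L f i j k x * snd x $ j) x" if "is_wirt D" for D
    by (rule is_wirt_cong[OF that open_S cf_L_eta[symmetric] assms])
  show "d_eta m (cf_N f i k) x = cf_L f i m k x"
    unfolding c[OF is_wirt_coord(3)] using assms
    by (simp add: D_rules if_distrib[of "\<lambda>a. _ * a"] cong: if_cong)
  show "d_etabar m (cf_N f i k) x = 0"
    unfolding c[OF is_wirt_coord(4)] using assms by (simp add: D_rules)
  show "d_zbar h (cf_N f i k) x = (\<Sum>j\<in>UNIV. B i j h k x * snd x $ j)"
    unfolding c[OF is_wirt_coord(2)] using assms by (simp add: D_rules)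
qed

text \<open>By \<open>d_cf_N\<close> this is \<open>d_zbar h (cf_N f i k) x\<close>, the curvature
  of the nonlinear connection.\<close>

definition V :: "2 \<Rightarrow> 2 \<Rightarrow> 2 \<Rightarrow> 2 cfun" where
  "V i h k x = (\<Sum>j\<in>UNIV. B i j h k x * snd x $ j)"

text \<open>Neither \<open>cf_L\<close> nor \<open>cf_N\<close> depends on the conjugate of
  \<open>\<eta>\<close>, so \<open>delta_bar\<close> acts on both as \<open>d_zbar\<close>.\<close>

lemma curv_eq:
  assumes "x \<in> S"
  shows "curv f r j h k x = - (\<Sum>i\<in>UNIV. G i r x * B i j h k x)
      - (\<Sum>l\<in>UNIV. V l h k x * d_eta l (G j r) x)"
proof -
  have up: "curv_up f i j h k x = - B i j h k x - (\<Sum>l\<in>UNIV. V l h k x * cf_C f i j l x)" for i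
    using assms by (simp add: curv_up_def delta_bar_def d_cf_N V_def)
  have "curv f r j h k x = - (\<Sum>i\<in>UNIV. G i r x * B i j h k x)
      - (\<Sum>l\<in>UNIV. V l h k x * (\<Sum>i\<in>UNIV. G i r x * cf_C f i j l x))"
    unfolding curv_def up by (simp add: sum_2 algebra_simps)
  then show ?thesis unfolding G_cf_C[OF assms] .
qed

text \<open>Contracting the second term of \<open>curv_eq\<close> over the unbarred index of the
  metric kills it by \<open>eta_dG\<close>; contracting over the barred one turns it into
  \<open>H\<close> by \<open>etabar_dG\<close>. Equality of the two curvatures thus becomes a linear
  equation for the columns of \<open>H\<close>.\<close>

lemma curv_contractions:
  assumes "x \<in> S"
  shows "curv_000k f k x = - (\<Sum>h\<in>UNIV. cnj (snd x $ h) * (\<Sum>i\<in>UNIV. d_eta i L x * V i h k x))"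
    "curv_0k00 f k x = - (\<Sum>h\<in>UNIV. cnj (snd x $ h) * (\<Sum>i\<in>UNIV. d_eta i L x * V i h k x))
      - (\<Sum>l\<in>UNIV. (\<Sum>h\<in>UNIV. \<Sum>j\<in>UNIV. cnj (snd x $ h) * snd x $ j * V l h j x) * H l k x)"
proof -
  have V: "(\<Sum>j\<in>UNIV. B i j h k x * snd x $ j) = V i h k x" for i h k
    by (simp add: V_def)
  have Vk: "(\<Sum>j\<in>UNIV. B i k h j x * snd x $ j) = V i h k x" for i h
    by (simp add: V_def B_sym[OF assms, where i = i and j = k])
  show "curv_000k f k x = - (\<Sum>h\<in>UNIV. cnj (snd x $ h) * (\<Sum>i\<in>UNIV. d_eta i L x * V i h k x))"
    unfolding curv_000k_def curv_eq[OF assms] contract_barred V etabar_G[OF assms] eta_dG[OF assms]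
    by simp
  show "curv_0k00 f k x = - (\<Sum>h\<in>UNIV. cnj (snd x $ h) * (\<Sum>i\<in>UNIV. d_eta i L x * V i h k x))
      - (\<Sum>l\<in>UNIV. (\<Sum>h\<in>UNIV. \<Sum>j\<in>UNIV. cnj (snd x $ h) * snd x $ j * V l h j x) * H l k x)"
    unfolding curv_0k00_def curv_eq[OF assms] contract_unbarred etabar_G[OF assms] etabar_dG[OF assms] Vk ..
qed

section \<open>Horizontal constancy of \<open>L\<close> and of its second derivatives\<close>

lemma dbar_L_N:
  assumes "x \<in> S"
  shows "d_zbar h L x = (\<Sum>j\<in>UNIV. d_etabar j L x * cnj (cf_N f j h x))"
  using arg_cong[OF dL_N[OF assms, of h], of cnj] assms by (simp add: cnj_dL)

lemma dbar_d_eta_L: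
  assumes "x \<in> S"
  shows "d_zbar h (d_eta i L) x = (\<Sum>j\<in>UNIV. G i j x * cnj (cf_N f j h x))"
proof -
  have "d_zbar h (d_eta i L) x = d_eta i (d_zbar h L) x"
    using assms by (intro D_commute is_wirt_coord) auto
  also have "\<dots> = d_eta i (\<lambda>x. \<Sum>j\<in>UNIV. d_etabar j L x * cnj (cf_N f j h x)) x"
    by (rule D_cong[OF dbar_L_N assms])
  also have "\<dots> = (\<Sum>j\<in>UNIV. G i j x * cnj (cf_N f j h x))"
    using assms by (simp add: D_rules d_cf_N)
  finally show ?thesis .
qed

text \<open>Differentiating \<open>dL_N\<close> expresses the mixed derivative
  \<open>d_zbar h (d_z k L)\<close> as a Hermitian expression in \<open>h\<close> and
  \<open>k\<close> plus the contraction in question. The mixed derivative is itself Hermitian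
  because \<open>L\<close> is real.\<close>

lemma V_hermitian:
  assumes "x \<in> S"
  shows "cnj (\<Sum>i\<in>UNIV. d_eta i L x * V i h k x) = (\<Sum>i\<in>UNIV. d_eta i L x * V i k h x)"
proof -
  have e: "d_zbar h (d_z k L) x = (\<Sum>i\<in>UNIV. \<Sum>j\<in>UNIV. G i j x * cnj (cf_N f j h x) * cf_N f i k x)
      + (\<Sum>i\<in>UNIV. d_eta i L x * V i h k x)" for h k
  proof -
    have "d_zbar h (d_z k L) x = d_zbar h (\<lambda>x. \<Sum>i\<in>UNIV. d_eta i L x * cf_N f i k x) x"
      by (rule D_cong[OF dL_N[symmetric] assms])
    then show ?thesis
      using assms by (simp add: D_rules d_cf_N dbar_d_eta_L V_def sum.distrib sum_distrib_right)
  qed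
  have "cnj (d_zbar h (d_z k L) x) = d_z h (\<lambda>x. cnj (d_z k L x)) x"
    using assms by (simp add: D_cnj)
  also have "\<dots> = d_z h (d_zbar k L) x"
    by (rule D_cong[OF _ assms]) (simp add: cnj_dL)
  also have "\<dots> = d_zbar k (d_z h L) x"
    using assms by (intro D_commute is_wirt_coord) auto
  finally have "cnj (d_zbar h (d_z k L) x) = d_zbar k (d_z h L) x" .
  moreover have "cnj (\<Sum>i\<in>UNIV. \<Sum>j\<in>UNIV. G i j x * cnj (cf_N f j h x) * cf_N f i k x) =
      (\<Sum>i\<in>UNIV. \<Sum>j\<in>UNIV. G i j x * cnj (cf_N f j k x) * cf_N f i h x)"
    using assms by (simp add: sum_2 cnj_G algebra_simps)
  ultimately show ?thesis
    unfolding e by simp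
qed

text \<open>Two fibre derivatives of \<open>dL_N\<close>, with \<open>cf_N\<close> linear in
  \<open>\<eta>\<close>. Moving the last term to the left shows that \<open>H\<close> is covariantly
  constant along \<open>delta f k\<close>.\<close>

lemma dz_H:
  assumes "x \<in> S"
  shows "d_z k (H a b) x = (\<Sum>i\<in>UNIV. cf_L f i a k x * H i b x + cf_L f i b k x * H i a x
      + cf_N f i k x * d_eta i (H a b) x)"
proof -
  have 1: "d_z k (d_eta b L) x = (\<Sum>i\<in>UNIV. H b i x * cf_N f i k x + d_eta i L x * cf_L f i b k x)"
    if "x \<in> S" for x
  proof -
    have "d_z k (d_eta b L) x = d_eta b (d_z k L) x"
      using that by (intro D_commute is_wirt_coord) auto
    also have "\<dots> = d_eta b (\<lambda>x. \<Sum>i\<in>UNIV. d_eta i L x * cf_N f i k x) x"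
      by (rule D_cong[OF dL_N[symmetric] that])
    finally show ?thesis using that by (simp add: D_rules d_cf_N)
  qed
  have "d_z k (H a b) x = d_eta a (d_z k (d_eta b L)) x"
    using assms by (intro D_commute is_wirt_coord) auto
  also have "\<dots> = d_eta a (\<lambda>x. \<Sum>i\<in>UNIV. H b i x * cf_N f i k x + d_eta i L x * cf_L f i b k x) x"
    by (rule D_cong[OF 1 assms])
  also have "\<dots> = (\<Sum>i\<in>UNIV. d_eta a (H b i) x * cf_N f i k x + H b i x * cf_L f i a k x
      + H a i x * cf_L f i b k x)"
    using assms by (simp add: D_rules d_cf_N)
  finally have "d_z k (H a b) x = (\<Sum>i\<in>UNIV. d_eta a (H b i) x * cf_N f i k x + H b i x * cf_L f i a k x
      + H a i x * cf_L f i b k x)" .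
  moreover have "d_eta a (H b i) x = d_eta i (H a b) x" for i
  proof -
    have "d_eta a (H b i) x = d_eta a (H i b) x"
      by (rule D_cong[OF H_sym assms])
    also have "\<dots> = d_eta i (H a b) x"
      using assms by (intro D_commute is_wirt_coord) auto
    finally show ?thesis .
  qed
  moreover have "H b i x = H i b x" "H a i x = H i a x" for i
    by (rule H_sym[OF assms])+
  ultimately show ?thesis by (simp add: algebra_simps)
qed

text \<open>The conjugate of \<open>cf_N\<close> has no holomorphic fibre derivative, so
  differentiating \<open>dbar_d_eta_L\<close> yields no connection terms:
  \<open>delta_bar f k (H a b)\<close> vanishes.\<close>

lemma dzbar_H:
  assumes "x \<in> S"
  shows "d_zbar k (H a b) x = (\<Sum>j\<in>UNIV. cnj (cf_N f j k x) * d_etabar j (H a b) x)"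
proof -
  have "d_zbar k (H a b) x = d_eta a (d_zbar k (d_eta b L)) x"
    using assms by (intro D_commute is_wirt_coord) auto
  also have "\<dots> = d_eta a (\<lambda>x. \<Sum>j\<in>UNIV. G b j x * cnj (cf_N f j k x)) x"
    by (rule D_cong[OF dbar_d_eta_L assms])
  also have "\<dots> = (\<Sum>j\<in>UNIV. d_eta a (G b j) x * cnj (cf_N f j k x))"
    using assms by (simp add: D_rules d_cf_N)
  finally have "d_zbar k (H a b) x = (\<Sum>j\<in>UNIV. d_eta a (G b j) x * cnj (cf_N f j k x))" .
  moreover have "d_eta a (G b j) x = d_etabar j (H a b) x" for j
  proof -
    have "d_eta a (G b j) x = d_eta a (d_etabar j (d_eta b L)) x"
      by (rule D_cong[OF _ assms]) (intro D_commute is_wirt_coord; simp)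
    also have "\<dots> = d_etabar j (H a b) x"
      using assms by (intro D_commute is_wirt_coord) auto
    finally show ?thesis .
  qed
  ultimately show ?thesis by (simp add: mult.commute)
qed

end

section \<open>Flatness of fibres with nonzero A\<close>

context berwald_chart
begin

section \<open>Polynomial identities in the fibre variable\<close>

lemma fibre_const_uminus: "fibre_const u \<Longrightarrow> fibre_const (\<lambda>x. - u x)"
  using fibre_const_cmult[of u "-1"] by simp

text \<open>Points around which \<open>L\<close> is not a Hermitian quadratic form in
  \<open>\<eta>\<close>, equivalently those with \<open>A \<noteq> 0\<close>. The set is open, so
  identities on it may be differentiated.\<close>

definition nonquad :: "((complex^2) \<times> (complex^2)) set" where
  "nonquad = {x \<in> S. \<exists>i j. H i j x \<noteq> 0}"

lemma open_nonquad: "open nonquad"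
proof -
  have *: "nonquad = (\<Union>i. \<Union>j. S \<inter> H i j -` (- {0}))" by (auto simp: nonquad_def)
  have "open (S \<inter> H i j -` (- {0}))" for i j
    by (rule continuous_open_preimage[OF smooth_on_continuous open_S]) auto
  then show ?thesis unfolding * by blast
qed

lemma nonquad_S: "x \<in> nonquad \<Longrightarrow> x \<in> S"
  by (simp add: nonquad_def)

lemma D_zero_on_nonquad:
  assumes "\<forall>x\<in>nonquad. u x = 0" "x \<in> nonquad"
  shows "d_eta k u x = 0" "d_etabar k u x = 0"
proof -
  have "D u x = D (\<lambda>x. 0) x" if "is_wirt D" for D
    by (rule is_wirt_cong[OF that open_nonquad _ assms(2)]) (use assms(1) in blast)
  from this[OF is_wirt_coord(3)] this[OF is_wirt_coord(4)]
  show "d_eta k u x = 0" "d_etabar k u x = 0" by (simp_all add: D_const)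
qed

text \<open>The coefficients have no fibre derivatives, so a derivative in \<open>\<eta>\<close>
  isolates each of them. The quadratic and cubic versions reduce the degree in the same way.\<close>

lemma linear_form_zero:
  assumes u: "fibre_const u" "fibre_const w"
    and z: "\<forall>x\<in>nonquad. u x * snd x $ 1 + w x * snd x $ 2 = 0"
    and x: "x \<in> nonquad"
  shows "u x = 0" "w x = 0"
  using D_zero_on_nonquad(1)[where k = 1, OF z x] D_zero_on_nonquad(1)[where k = 2, OF z x] nonquad_S[OF x] u
  by (simp_all add: D_rules fibre_const_smooth fibre_const_d)

lemma quadratic_form_zero:
  assumes u: "fibre_const u" "fibre_const v" "fibre_const w"
    and z: "\<forall>x\<in>nonquad. u x * (snd x $ 1 * snd x $ 1) + v x * (snd x $ 1 * snd x $ 2)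
      + w x * (snd x $ 2 * snd x $ 2) = 0"
    and x: "x \<in> nonquad"
  shows "u x = 0" "v x = 0" "w x = 0"
proof -
  have 1: "\<forall>x\<in>nonquad. 2 * u x * snd x $ 1 + v x * snd x $ 2 = 0"
  proof
    fix x assume that: "x \<in> nonquad"
    show "2 * u x * snd x $ 1 + v x * snd x $ 2 = 0"
      using D_zero_on_nonquad(1)[where k = 1, OF z that] nonquad_S[OF that] u
      by (simp add: D_rules fibre_const_smooth fibre_const_d algebra_simps)
  qed
  have 2: "\<forall>x\<in>nonquad. v x * snd x $ 1 + 2 * w x * snd x $ 2 = 0"
  proof
    fix x assume that: "x \<in> nonquad"
    show "v x * snd x $ 1 + 2 * w x * snd x $ 2 = 0"
      using D_zero_on_nonquad(1)[where k = 2, OF z that] nonquad_S[OF that] u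
      by (simp add: D_rules fibre_const_smooth fibre_const_d algebra_simps)
  qed
  show "u x = 0" "v x = 0" "w x = 0"
    using linear_form_zero[OF _ _ 1 x] linear_form_zero[OF _ _ 2 x] u by (simp_all add: fibre_const_cmult)
qed

lemma cubic_form_zero:
  assumes u: "fibre_const p" "fibre_const u" "fibre_const v" "fibre_const w"
    and z: "\<forall>x\<in>nonquad. p x * (snd x $ 1 * (snd x $ 1 * snd x $ 1)) + u x * (snd x $ 1 * (snd x $ 1 * snd x $ 2))
      + v x * (snd x $ 1 * (snd x $ 2 * snd x $ 2)) + w x * (snd x $ 2 * (snd x $ 2 * snd x $ 2)) = 0"
    and x: "x \<in> nonquad"
  shows "p x = 0" "u x = 0" "v x = 0" "w x = 0"
proof -
  have 1: "\<forall>x\<in>nonquad. 3 * p x * (snd x $ 1 * snd x $ 1) + 2 * u x * (snd x $ 1 * snd x $ 2)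
      + v x * (snd x $ 2 * snd x $ 2) = 0"
  proof
    fix x assume that: "x \<in> nonquad"
    show "3 * p x * (snd x $ 1 * snd x $ 1) + 2 * u x * (snd x $ 1 * snd x $ 2)
      + v x * (snd x $ 2 * snd x $ 2) = 0"
      using D_zero_on_nonquad(1)[where k = 1, OF z that] nonquad_S[OF that] u
      by (simp add: D_rules fibre_const_smooth fibre_const_d algebra_simps)
  qed
  have 2: "\<forall>x\<in>nonquad. u x * (snd x $ 1 * snd x $ 1) + 2 * v x * (snd x $ 1 * snd x $ 2)
      + 3 * w x * (snd x $ 2 * snd x $ 2) = 0"
  proof
    fix x assume that: "x \<in> nonquad"
    show "u x * (snd x $ 1 * snd x $ 1) + 2 * v x * (snd x $ 1 * snd x $ 2)
      + 3 * w x * (snd x $ 2 * snd x $ 2) = 0"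
      using D_zero_on_nonquad(1)[where k = 2, OF z that] nonquad_S[OF that] u
      by (simp add: D_rules fibre_const_smooth fibre_const_d algebra_simps)
  qed
  show "p x = 0" "u x = 0" "v x = 0" "w x = 0"
    using quadratic_form_zero[OF _ _ _ 1 x] quadratic_form_zero[OF _ _ _ 2 x] u
    by (simp_all add: fibre_const_cmult)
qed

text \<open>A derivative in the conjugate variable with index \<open>h\<close> leaves a linear form
  in \<open>\<eta>\<close>.\<close>

lemma sesquilinear_form_zero:
  assumes c: "\<And>h k. fibre_const (c h k)"
    and z: "\<forall>x\<in>nonquad. (\<Sum>h\<in>UNIV. \<Sum>k\<in>UNIV. c h k x * (cnj (snd x $ h) * snd x $ k)) = 0"
    and x: "x \<in> nonquad"
  shows "c h k x = 0"
proof -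
  have "\<forall>x\<in>nonquad. c h 1 x * snd x $ 1 + c h 2 x * snd x $ 2 = 0" for h
  proof
    fix x assume that: "x \<in> nonquad"
    have "(\<Sum>h'\<in>UNIV. \<Sum>k\<in>UNIV. c h' k x * (cnj (if h' = h then 1 else 0) * snd x $ k)) = 0"
      using D_zero_on_nonquad(2)[where k = h, OF z that] nonquad_S[OF that] c
      by (simp add: D_rules fibre_const_smooth fibre_const_d)
    then show "c h 1 x * snd x $ 1 + c h 2 x * snd x $ 2 = 0"
      using exhaust_2[of h] by (auto simp: sum_2)
  qed
  from linear_form_zero[OF c c this x] show ?thesis using exhaust_2[of k] by auto
qed

section \<open>Consequences of the symmetry of the contracted curvature\<close>

context
  assumes symmetric_curv: "\<And>x k. x \<in> S \<Longrightarrow> curv_0k00 f k x = curv_000k f k x"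
begin

text \<open>Both \<open>W\<close> and \<open>\<eta>\<close> annihilate a nonzero column of
  \<open>H\<close>, by \<open>curv_contractions\<close> and \<open>eta_H\<close>; in dimension 2
  this makes them proportional.\<close>

lemma W_parallel:
  assumes x: "x \<in> nonquad"
  defines "W \<equiv> \<lambda>l. \<Sum>h\<in>UNIV. \<Sum>j\<in>UNIV. cnj (snd x $ h) * snd x $ j * V l h j x"
  shows "W 1 * snd x $ 2 = W 2 * snd x $ 1"
proof -
  have xS: "x \<in> S" by (rule nonquad_S[OF x])
  obtain i k where ik: "H i k x \<noteq> 0" using x by (auto simp: nonquad_def)
  have "(\<Sum>l\<in>UNIV. W l * H l k x) = 0"
    using symmetric_curv[OF xS, of k] unfolding curv_contractions[OF xS] W_def by simp
  then have 1: "W 1 * H 1 k x + W 2 * H 2 k x = 0"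
    by (simp add: sum_2)
  have 2: "snd x $ 1 * H 1 k x + snd x $ 2 * H 2 k x = 0"
    using eta_H[OF xS, of k] by (simp add: sum_2)
  have "H 1 k x \<noteq> 0 \<or> H 2 k x \<noteq> 0" using ik exhaust_2[of i] by auto
  moreover have "H 1 k x * (W 1 * snd x $ 2 - W 2 * snd x $ 1) = 0"
    "H 2 k x * (W 1 * snd x $ 2 - W 2 * snd x $ 1) = 0"
    using 1 2 by algebra+
  ultimately show ?thesis by auto
qed

text \<open>\<open>W_parallel\<close> is a polynomial identity with fibre-constant coefficients,
  which are compared first in the conjugate variable and then in \<open>\<eta>\<close>.\<close>

lemma B_components:
  assumes x: "x \<in> nonquad"
  shows "B 2 1 h 1 x = 0" "B 1 2 h 2 x = 0" "B 1 1 h 1 x = 2 * B 2 1 h 2 x" "B 2 2 h 2 x = 2 * B 1 1 h 2 x"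
proof -
  \<comment> \<open>\<open>P h\<close> is the coefficient of \<open>cnj (snd x $ h)\<close> in
    \<open>W 1 * snd x $ 2 - W 2 * snd x $ 1\<close>, a cubic form in \<open>\<eta>\<close>.\<close>
  define P where "P h x = - B 2 1 h 1 x * (snd x $ 1 * (snd x $ 1 * snd x $ 1))
      + (B 1 1 h 1 x - 2 * B 2 1 h 2 x) * (snd x $ 1 * (snd x $ 1 * snd x $ 2))
      + (2 * B 1 1 h 2 x - B 2 2 h 2 x) * (snd x $ 1 * (snd x $ 2 * snd x $ 2))
      + B 1 2 h 2 x * (snd x $ 2 * (snd x $ 2 * snd x $ 2))" for h x
  have z: "\<forall>x\<in>nonquad. cnj (snd x $ 1) * P 1 x + cnj (snd x $ 2) * P 2 x = 0"
  proof
    fix x assume that: "x \<in> nonquad"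
    have s: "B i 2 h 1 x = B i 1 h 2 x" for i h by (rule B_sym[OF nonquad_S[OF that]])
    show "cnj (snd x $ 1) * P 1 x + cnj (snd x $ 2) * P 2 x = 0"
      using W_parallel[OF that] unfolding V_def P_def sum_2 s by algebra
  qed
  have "P h x = 0" if "x \<in> nonquad" for x
    using D_zero_on_nonquad(2)[where k = h, OF z that] exhaust_2[of h] nonquad_S[OF that] unfolding P_def
    by (auto simp: D_rules)
  then have P: "\<forall>x\<in>nonquad. - B 2 1 h 1 x * (snd x $ 1 * (snd x $ 1 * snd x $ 1))
      + (B 1 1 h 1 x - 2 * B 2 1 h 2 x) * (snd x $ 1 * (snd x $ 1 * snd x $ 2))
      + (2 * B 1 1 h 2 x - B 2 2 h 2 x) * (snd x $ 1 * (snd x $ 2 * snd x $ 2))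
      + B 1 2 h 2 x * (snd x $ 2 * (snd x $ 2 * snd x $ 2)) = 0"
    by (simp add: P_def)
  have fc: "fibre_const (\<lambda>x. - B 2 1 h 1 x)" "fibre_const (\<lambda>x. B 1 1 h 1 x - 2 * B 2 1 h 2 x)"
    "fibre_const (\<lambda>x. 2 * B 1 1 h 2 x - B 2 2 h 2 x)"
    by (intro fibre_const_uminus fibre_const_diff fibre_const_cmult fibre_const_B)+
  show "B 2 1 h 1 x = 0" "B 1 2 h 2 x = 0" "B 1 1 h 1 x = 2 * B 2 1 h 2 x" "B 2 2 h 2 x = 2 * B 1 1 h 2 x"
    using cubic_form_zero[OF fc fibre_const_B P x] by simp_all
qed

lemma B_zero_on_nonquad:
  assumes x: "x \<in> nonquad"
  shows "B i j h k x = 0"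
proof -
  \<comment> \<open>On \<open>nonquad\<close>, by \<open>B_components\<close> and
    \<open>B_sym\<close>, twice \<open>B i j h k\<close> is \<open>lam h k\<close> if
    \<open>i = j\<close> plus \<open>lam h j\<close> if \<open>i = k\<close>. Hence
    \<open>lam\<close> carries all of \<open>B\<close>.\<close>
  define lam where "lam h k = B k k h k" for h k
  \<comment> \<open>Once \<open>lam\<close> is known to be Hermitian, \<open>\<rho> h\<close> is
    \<open>d_eta h \<phi>\<close>. Written with conjugates, it visibly has no holomorphic fibre
    derivative.\<close>
  define \<rho> where "\<rho> h x = (\<Sum>k\<in>UNIV. cnj (lam h k x) * cnj (snd x $ k))" for h x
  define \<phi> where "\<phi> x = (\<Sum>h\<in>UNIV. \<Sum>k\<in>UNIV. lam h k x * (cnj (snd x $ h) * snd x $ k))" for x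
  have lam_fc [simp]: "fibre_const (lam h k)" for h k by (simp add: lam_def)
  note [simp] = fibre_const_smooth[OF lam_fc] fibre_const_d[OF lam_fc]
  have \<Psi>: "2 * (\<Sum>i\<in>UNIV. d_eta i L x * V i h k x) = cnj (\<rho> h x) * d_eta k L x + lam h k x * L x"
    if "x \<in> nonquad" for x h k
  proof -
    have s: "B i 2 h 1 x = B i 1 h 2 x" for i h by (rule B_sym[OF nonquad_S[OF that]])
    have "2 * (\<Sum>i\<in>UNIV. d_eta i L x * V i h k x) = cnj (\<rho> h x) * d_eta k L x
        + lam h k x * (\<Sum>i\<in>UNIV. snd x $ i * d_eta i L x)"
      using exhaust_2[of k] B_components[OF that, of h]
      by (auto simp: V_def \<rho>_def lam_def sum_2 s algebra_simps)
    then show ?thesis unfolding euler[OF nonquad_S[OF that]] .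
  qed
  have E: "cnj (\<rho> h x) * d_eta k L x + lam h k x * L x = \<rho> k x * cnj (d_eta h L x) + cnj (lam k h x) * L x"
    if "x \<in> nonquad" for x h k
  proof -
    have "cnj (\<rho> h x) * d_eta k L x + lam h k x * L x = cnj (2 * (\<Sum>i\<in>UNIV. d_eta i L x * V i k h x))"
      using V_hermitian[OF nonquad_S[OF that], of k h] \<Psi>[OF that, of h k] by simp
    also have "\<dots> = \<rho> k x * cnj (d_eta h L x) + cnj (lam k h x) * L x"
      unfolding \<Psi>[OF that] by (simp add: cnj_L)
    finally show ?thesis .
  qed
  \<comment> \<open>Contracting \<open>E\<close> with \<open>cnj (snd x $ h) * snd x $ k\<close>
    gives, by Euler's identity, twice the form of \<open>lam\<close> times \<open>L\<close> on one
    side and twice that of its conjugate transpose times \<open>L\<close> on the other.\<close>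
  have lam_herm: "lam h k x = cnj (lam k h x)" if "x \<in> nonquad" for x h k
  proof -
    have "\<forall>x\<in>nonquad. (\<Sum>h\<in>UNIV. \<Sum>k\<in>UNIV. (lam h k x - cnj (lam k h x)) * (cnj (snd x $ h) * snd x $ k)) = 0"
    proof
      fix x assume that: "x \<in> nonquad"
      have e: "snd x $ 1 * d_eta 1 L x + snd x $ 2 * d_eta 2 L x = L x"
        "cnj (snd x $ 1) * cnj (d_eta 1 L x) + cnj (snd x $ 2) * cnj (d_eta 2 L x) = L x"
        using euler[OF nonquad_S[OF that]] euler_bar[OF nonquad_S[OF that]] cnj_dL[OF nonquad_S[OF that]]
        by (simp_all add: sum_2)
      let ?\<phi> = "\<Sum>h\<in>UNIV. \<Sum>k\<in>UNIV. lam h k x * (cnj (snd x $ h) * snd x $ k)"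
        and ?\<psi> = "\<Sum>h\<in>UNIV. \<Sum>k\<in>UNIV. cnj (lam k h x) * (cnj (snd x $ h) * snd x $ k)"
      have r: "cnj (snd x $ 1) * cnj (\<rho> 1 x) + cnj (snd x $ 2) * cnj (\<rho> 2 x) = ?\<phi>"
        "snd x $ 1 * \<rho> 1 x + snd x $ 2 * \<rho> 2 x = ?\<psi>"
        by (simp_all add: \<rho>_def sum_2 algebra_simps)
      have "(\<Sum>h\<in>UNIV. \<Sum>k\<in>UNIV. cnj (snd x $ h) * snd x $ k *
            (cnj (\<rho> h x) * d_eta k L x + lam h k x * L x)) =
          (\<Sum>h\<in>UNIV. \<Sum>k\<in>UNIV. cnj (snd x $ h) * snd x $ k *
            (\<rho> k x * cnj (d_eta h L x) + cnj (lam k h x) * L x))"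
        by (simp only: E[OF that])
      then have "(cnj (snd x $ 1) * cnj (\<rho> 1 x) + cnj (snd x $ 2) * cnj (\<rho> 2 x)) *
            (snd x $ 1 * d_eta 1 L x + snd x $ 2 * d_eta 2 L x) + ?\<phi> * L x =
          (snd x $ 1 * \<rho> 1 x + snd x $ 2 * \<rho> 2 x) *
            (cnj (snd x $ 1) * cnj (d_eta 1 L x) + cnj (snd x $ 2) * cnj (d_eta 2 L x)) + ?\<psi> * L x"
        by (simp add: sum_2 algebra_simps)
      then have "?\<phi> * L x = ?\<psi> * L x" unfolding e r by simp
      then have "?\<phi> = ?\<psi>" using L_nonzero[OF nonquad_S[OF that]] by simp
      then show "(\<Sum>h\<in>UNIV. \<Sum>k\<in>UNIV. (lam h k x - cnj (lam k h x)) * (cnj (snd x $ h) * snd x $ k)) = 0"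
        by (simp add: left_diff_distrib sum_subtractf)
    qed
    from sesquilinear_form_zero[OF _ this \<open>x \<in> nonquad\<close>, of h k] show ?thesis
      by (simp add: fibre_const_diff fibre_const_cnj)
  qed
  \<comment> \<open>With \<open>lam\<close> Hermitian the terms containing \<open>L\<close> cancel
    in \<open>E\<close>; what is left is contracted with the conjugate of
    \<open>\<eta>\<close>.\<close>
  have \<rho>L: "\<rho> h x * L x = \<phi> x * d_eta h L x" if "x \<in> nonquad" for x h
  proof -
    have e: "cnj (snd x $ 1) * cnj (d_eta 1 L x) + cnj (snd x $ 2) * cnj (d_eta 2 L x) = L x"
      using euler_bar[OF nonquad_S[OF that]] cnj_dL[OF nonquad_S[OF that]] by (simp add: sum_2)
    have "cnj (\<rho> k x) * d_eta h L x = \<rho> h x * cnj (d_eta k L x)" for k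
      using E[OF that, of k h] lam_herm[OF that, of k h] by simp
    note r = this[of 1] this[of 2]
    have "\<phi> x = cnj (snd x $ 1) * cnj (\<rho> 1 x) + cnj (snd x $ 2) * cnj (\<rho> 2 x)"
      by (simp add: \<phi>_def \<rho>_def sum_2 algebra_simps)
    then show ?thesis using r e by algebra
  qed
  have \<phi>0: "\<phi> x = 0" if "x \<in> nonquad" for x
  proof -
    obtain l h where H: "H l h x \<noteq> 0" using \<open>x \<in> nonquad\<close> by (auto simp: nonquad_def)
    \<comment> \<open>Differentiating \<open>\<rho>L\<close> leaves \<open>\<phi> * H\<close> as the
      difference of \<open>\<rho> h * d_eta l L\<close> and \<open>\<rho> l * d_eta h L\<close>.
      Multiplied by \<open>L\<close>, both products become the same by
      \<open>\<rho>L\<close>.\<close>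
    have "d_eta l (\<lambda>x. \<rho> h x * L x - \<phi> x * d_eta h L x) x = 0"
      by (rule D_zero_on_nonquad(1)[OF _ that]) (simp add: \<rho>L)
    moreover have "d_eta l (\<rho> h) x = 0"
      using nonquad_S[OF that] unfolding \<rho>_def[abs_def] by (simp add: D_rules)
    moreover have "d_eta l \<phi> x = \<rho> l x"
    proof -
      have "d_eta l \<phi> x = (\<Sum>h\<in>UNIV. \<Sum>k\<in>UNIV. lam h k x * (cnj (snd x $ h) * (if k = l then 1 else 0)))"
        using nonquad_S[OF that] unfolding \<phi>_def[abs_def] by (simp add: D_rules)
      also have "\<dots> = (\<Sum>h\<in>UNIV. lam h l x * cnj (snd x $ h))"
        using exhaust_2[of l] by (auto simp: sum_2)
      also have "\<dots> = \<rho> l x"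
        using lam_herm[OF that, of _ l] by (simp add: \<rho>_def)
      finally show ?thesis .
    qed
    moreover have "smooth_on (\<rho> h) S" "smooth_on \<phi> S"
      unfolding \<rho>_def[abs_def] \<phi>_def[abs_def] by simp_all
    ultimately have "\<rho> h x * d_eta l L x = \<rho> l x * d_eta h L x + \<phi> x * H l h x"
      using nonquad_S[OF that] by (simp add: D_rules)
    then have "\<phi> x * H l h x * L x = 0"
      using \<rho>L[OF that, of h] \<rho>L[OF that, of l] by algebra
    then show ?thesis using H L_nonzero[OF nonquad_S[OF that]] by simp
  qed
  have lam0: "lam h k x = 0" for h k
    by (rule sesquilinear_form_zero[OF lam_fc _ x]) (use \<phi>0 in \<open>simp add: \<phi>_def\<close>)
  have "B 1 2 h 1 x = B 1 1 h 2 x" "B 2 2 h 1 x = B 2 1 h 2 x"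
    by (rule B_sym[OF nonquad_S[OF x]])+
  then show ?thesis
    using lam0[of h 1] lam0[of h 2] B_components[OF x, of h] exhaust_2[of i] exhaust_2[of j] exhaust_2[of k]
    unfolding lam_def by auto
qed

text \<open>\<open>B\<close> does not depend on \<open>\<eta>\<close>, so its vanishing at one
  vector with \<open>A \<noteq> 0\<close> holds on the whole fibre.\<close>

lemma curv_zero:
  assumes "z \<in> Z" "\<eta> \<noteq> 0" "A_inv f (z, \<eta>) \<noteq> 0" "\<eta>' \<noteq> 0"
  shows "curv f r j h k (z, \<eta>') = 0"
proof -
  have "(z, \<eta>) \<in> nonquad" using assms A_inv_eq_0_iff[of "(z, \<eta>)"] by (auto simp: nonquad_def)
  from B_zero_on_nonquad[OF this] have "B i j h k (z, \<eta>') = 0" for i j h k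
    using B_fibre[of z \<eta> \<eta>'] assms by simp
  then show ?thesis
    using assms by (simp add: curv_eq V_def)
qed

end

end

section \<open>Propagation of the vanishing of A\<close>

text \<open>The chain rule inside a single fibre, both base points being fixed. It serves scalings
  of one fibre as well as changes of chart.\<close>

lemma d_eta_linear_comp:
  fixes u u' :: "'n::finite cfun" and J :: "complex^'n \<Rightarrow> complex^'n"
  assumes u: "u differentiable (at (z, \<eta>))" and u': "u' differentiable (at (z', J \<eta>))"
    and J: "bounded_linear J" "\<And>v. J (\<i> *s v) = \<i> *s J v"
    and eq: "\<And>\<zeta>. \<zeta> \<noteq> 0 \<Longrightarrow> u' (z', J \<zeta>) = c * u (z, \<zeta>)" and "\<eta> \<noteq> 0"
  shows "(\<Sum>a\<in>UNIV. J (axis i 1) $ a * d_eta a u' (z', J \<eta>)) = c * d_eta i u (z, \<eta>)"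
proof -
  have d1: "((\<lambda>\<zeta>. (z, \<zeta>)) has_derivative (\<lambda>w. (0, w))) (at \<eta>)"
    by (auto intro!: derivative_eq_intros)
  from diff_chain_at[OF this fdv_has_derivative[OF u]]
  have "((\<lambda>\<zeta>. u (z, \<zeta>)) has_derivative (\<lambda>w. fdv (0, w) u (z, \<eta>))) (at \<eta>)"
    by (simp add: o_def)
  then have "((\<lambda>\<zeta>. c * u (z, \<zeta>)) has_derivative (\<lambda>w. c * fdv (0, w) u (z, \<eta>))) (at \<eta>)"
    by (rule has_derivative_mult_right)
  then have 1: "((\<lambda>\<zeta>. u' (z', J \<zeta>)) has_derivative (\<lambda>w. c * fdv (0, w) u (z, \<eta>))) (at \<eta>)"
    by (rule has_derivative_transform_within_open[of _ _ _ _ "UNIV - {0}"])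
      (use eq \<open>\<eta> \<noteq> 0\<close> in \<open>auto simp: open_delete\<close>)
  have d2: "((\<lambda>\<zeta>. (z', J \<zeta>)) has_derivative (\<lambda>w. (0, J w))) (at \<eta>)"
    by (intro has_derivative_Pair has_derivative_const bounded_linear_imp_has_derivative J)
  from diff_chain_at[OF this fdv_has_derivative[OF u']]
  have 2: "((\<lambda>\<zeta>. u' (z', J \<zeta>)) has_derivative (\<lambda>w. fdv (0, J w) u' (z', J \<eta>))) (at \<eta>)"
    by (simp add: o_def)
  have e: "c * fdv (0, w) u (z, \<eta>) = fdv (0, J w) u' (z', J \<eta>)" for w
    using fun_cong[OF has_derivative_unique[OF 1 2]] .
  have a: "axis i \<i> = \<i> *s (axis i 1 :: complex^'n)"
    by (simp add: vec_eq_iff axis_def)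
  \<comment> \<open>As \<open>J\<close> commutes with \<open>\<i>\<close>, both real directions come
    from the one vector \<open>J (axis i 1)\<close>, and the antiholomorphic derivatives cancel in
    the expansion below.\<close>
  have "c * d_eta i u (z, \<eta>) = (fdv (0, J (axis i 1)) u' (z', J \<eta>)
      - \<i> * fdv (0, \<i> *s J (axis i 1)) u' (z', J \<eta>)) / 2"
    unfolding d_eta_def using e[of "axis i 1"] e[of "axis i \<i>"]
    by (simp add: a J(2) algebra_simps)
  also have "\<dots> = (\<Sum>a\<in>UNIV. J (axis i 1) $ a * d_eta a u' (z', J \<eta>))"
    unfolding fdv_expand[OF u']
    by (simp add: sum_distrib_left sum_divide_distrib diff_divide_distrib
        flip: sum_subtractf) (simp add: field_simps)
  finally show ?thesis by simp
qed

section \<open>Behaviour of \<open>H\<close> under scaling and change of chart\<close>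

context finsler_chart
begin

lemma L_scale: "z \<in> Z \<Longrightarrow> L (z, of_real s *s \<eta>) = of_real (s\<^sup>2) * L (z, \<eta>)"
  by (simp add: L_fun_def f_scale power_mult_distrib)

text \<open>\<open>L\<close> has degree 2 under real scaling and each fibre derivative lowers the
  degree by one. This reduces statements about a fibre to its compact unit sphere.\<close>

lemma H_scale:
  assumes "z \<in> Z" "\<eta> \<noteq> 0" "s \<noteq> 0"
  shows "H i j (z, of_real s *s \<eta>) = H i j (z, \<eta>)"
proof -
  define J where "J \<zeta> = of_real s *s \<zeta>" for \<zeta> :: "complex^2"
  have Jb: "bounded_linear J"
    unfolding J_def linear_conv_bounded_linear[symmetric]
    by (rule linearI) (simp_all add: vec_eq_iff algebra_simps)
  have Ji: "J (\<i> *s v) = \<i> *s J v" for v by (simp add: J_def vec_eq_iff)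
  have J0: "J \<zeta> \<noteq> 0" if "\<zeta> \<noteq> 0" for \<zeta> using that assms(3) by (auto simp: J_def vec_eq_iff)
  have d: "u differentiable (at (z, \<zeta>))" if "smooth_on u S" "\<zeta> \<noteq> 0" for u and \<zeta>
    by (rule smooth_on_differentiable[OF that(1)]) (use that assms in auto)
  have sm: "(\<Sum>a\<in>UNIV. J (axis i 1) $ a * g a) = of_real s * g i" for i and g :: "2 \<Rightarrow> complex"
    using exhaust_2[of i] by (auto simp: J_def axis_def sum_2)
  have LJ: "L (z, J \<zeta>) = of_real (s\<^sup>2) * L (z, \<zeta>)" for \<zeta>
    by (simp add: J_def L_scale[OF assms(1)])
  have 1: "d_eta j L (z, J \<zeta>) = of_real s * d_eta j L (z, \<zeta>)" if "\<zeta> \<noteq> 0" for \<zeta>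
  proof -
    have "(\<Sum>a\<in>UNIV. J (axis j 1) $ a * d_eta a L (z, J \<zeta>)) = of_real (s\<^sup>2) * d_eta j L (z, \<zeta>)"
      by (rule d_eta_linear_comp[OF d d Jb Ji]) (use that J0 LJ in auto)
    then show ?thesis
      using assms(3) unfolding sm[of j "\<lambda>a. d_eta a L (z, J \<zeta>)"] by (simp add: power2_eq_square)
  qed
  have "(\<Sum>a\<in>UNIV. J (axis i 1) $ a * H a j (z, J \<eta>)) = of_real s * H i j (z, \<eta>)"
    by (rule d_eta_linear_comp[OF d d Jb Ji]) (use assms J0 1 in auto)
  then show ?thesis
    using assms(3) unfolding sm[of i "\<lambda>a. H a j (z, J \<eta>)"] by (simp add: J_def)
qed

end

text \<open>Two applications of \<open>d_eta_linear_comp\<close>. Only fibre derivatives occur, so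
  derivatives of the Jacobian along the base do not enter.\<close>

lemma H_chart_change:
  assumes f: "finsler_chart f Z" and f': "finsler_chart f' Z'"
    and J: "bounded_linear J" "\<And>v. J (\<i> *s v) = \<i> *s J v" "\<And>v. v \<noteq> 0 \<Longrightarrow> J v \<noteq> 0"
    and z: "z \<in> Z" "z' \<in> Z'" and eq: "\<And>\<eta>. f' (z', J \<eta>) = f (z, \<eta>)" and \<eta>: "\<eta> \<noteq> 0"
  shows "d_eta i (d_eta j (L_fun f)) (z, \<eta>) =
    (\<Sum>a\<in>UNIV. \<Sum>b\<in>UNIV. J (axis i 1) $ a * J (axis j 1) $ b * d_eta a (d_eta b (L_fun f')) (z', J \<eta>))"
proof -
  interpret F: finsler_chart f Z by (rule f)
  interpret F': finsler_chart f' Z' by (rule f')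
  have d: "u differentiable (at (z, \<zeta>))" if "smooth_on u F.S" "\<zeta> \<noteq> 0" for u and \<zeta>
    by (rule smooth_on_differentiable[OF that(1)]) (use that z in auto)
  have d': "u differentiable (at (z', J \<zeta>))" if "smooth_on u F'.S" "\<zeta> \<noteq> 0" for u and \<zeta>
    by (rule smooth_on_differentiable[OF that(1)]) (use that z J in auto)
  define u where "u x = (\<Sum>b\<in>UNIV. J (axis j 1) $ b * d_eta b (L_fun f') x)" for x
  have u: "smooth_on u F'.S" unfolding u_def[abs_def] by simp
  have 1: "u (z', J \<zeta>) = 1 * d_eta j (L_fun f) (z, \<zeta>)" if "\<zeta> \<noteq> 0" for \<zeta>
    unfolding u_def
    by (rule d_eta_linear_comp[OF d d' J(1,2)]) (use that eq in \<open>auto simp: L_fun_def\<close>)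
  have "1 * d_eta i (d_eta j (L_fun f)) (z, \<eta>) = (\<Sum>a\<in>UNIV. J (axis i 1) $ a * d_eta a u (z', J \<eta>))"
    by (rule d_eta_linear_comp[OF d d' J(1,2), symmetric]) (use \<eta> 1 u in auto)
  moreover have "d_eta a u (z', J \<eta>) = (\<Sum>b\<in>UNIV. J (axis j 1) $ b * d_eta a (d_eta b (L_fun f')) (z', J \<eta>))" for a
    unfolding u_def[abs_def] using z J(3)[OF \<eta>] by (simp add: F'.D_rules)
  ultimately show ?thesis by (simp add: sum_distrib_left mult.assoc)
qed

section \<open>A differential inequality for the size of \<open>H\<close>\<close>

context berwald_chart
begin

text \<open>The squared norm of \<open>H\<close> in this chart. It depends on the chart, but its
  zeros are those of \<open>H\<close>, and it is differentiable.\<close>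

definition q :: "(complex^2) \<times> (complex^2) \<Rightarrow> real" where
  "q x = (\<Sum>a\<in>UNIV. \<Sum>b\<in>UNIV. (cmod (H a b x))\<^sup>2)"

lemma q_has_derivative:
  assumes "x \<in> S"
  shows "(q has_derivative (\<lambda>w. \<Sum>a\<in>UNIV. \<Sum>b\<in>UNIV. 2 * (H a b x \<bullet> fdv w (H a b) x))) (at x)"
proof -
  have "((\<lambda>x. (cmod (H a b x))\<^sup>2) has_derivative (\<lambda>w. 2 * (H a b x \<bullet> fdv w (H a b) x))) (at x)" for a b
  proof -
    have "(H a b has_derivative (\<lambda>w. fdv w (H a b) x)) (at x)"
      by (rule fdv_has_derivative[OF smooth_on_differentiable[OF _ assms]]) simp
    from has_derivative_inner[OF this this] show ?thesis
      by (simp add: power2_norm_eq_inner inner_commute)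
  qed
  then show ?thesis unfolding q_def[abs_def] by (intro has_derivative_sum)
qed

lemma q_nonneg: "0 \<le> q x"
  by (simp add: q_def sum_nonneg)

lemma q_eq_0_iff: "q x = 0 \<longleftrightarrow> (\<forall>a b. H a b x = 0)"
  by (simp add: q_def sum_nonneg_eq_0_iff sum_nonneg)

text \<open>\<open>(v, w)\<close> is the horizontal lift of \<open>v\<close>; along it the fibre
  derivatives in \<open>dz_H\<close> and \<open>dzbar_H\<close> cancel.\<close>

lemma fdv_horizontal_H:
  assumes "x \<in> S" and w: "\<And>i. w $ i = - (\<Sum>k\<in>UNIV. cf_N f i k x * v $ k)"
  shows "fdv (v, w) (H a b) x =
    (\<Sum>k\<in>UNIV. v $ k * (\<Sum>i\<in>UNIV. cf_L f i a k x * H i b x + cf_L f i b k x * H i a x))"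
proof -
  have d: "H a b differentiable (at x)" by (rule smooth_on_differentiable[OF _ assms(1)]) simp
  show ?thesis
    unfolding fdv_expand[OF d] dz_H[OF assms(1)] dzbar_H[OF assms(1)] w
    by (simp add: sum_2 algebra_simps)
qed

text \<open>The constant is \<open>2 * 8 * 4\<close>: 2 from differentiating a square, 8 for the
  products in \<open>fdv_horizontal_H\<close>, and 4 from bounding the square of a sum of four
  moduli by the sum of their squares.\<close>

lemma fdv_horizontal_q:
  assumes "x \<in> S" and w: "\<And>i. w $ i = - (\<Sum>k\<in>UNIV. cf_N f i k x * v $ k)"
    and M: "\<And>i j k. cmod (cf_L f i j k x) \<le> M"
  shows "(\<Sum>a\<in>UNIV. \<Sum>b\<in>UNIV. 2 * (H a b x \<bullet> fdv (v, w) (H a b) x)) \<le> 64 * M * norm v * q x"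
proof -
  define \<sigma> where "\<sigma> = (\<Sum>a\<in>UNIV. \<Sum>b\<in>UNIV. cmod (H a b x))"
  have H\<sigma>: "cmod (H a b x) \<le> \<sigma>" for a b
    unfolding \<sigma>_def sum_2 using exhaust_2[of a] exhaust_2[of b]
      norm_ge_zero[of "H 1 1 x"] norm_ge_zero[of "H 1 2 x"] norm_ge_zero[of "H 2 1 x"] norm_ge_zero[of "H 2 2 x"]
    by (elim disjE; simp only:; linarith)
  have \<sigma>0: "0 \<le> \<sigma>" using norm_ge_zero H\<sigma> by (rule order_trans)
  have M0: "0 \<le> M" using norm_ge_zero M by (rule order_trans)
  have b: "cmod (fdv (v, w) (H a b) x) \<le> 8 * M * norm v * \<sigma>" for a b
  proof -
    have "cmod (v $ k * (\<Sum>i\<in>UNIV. cf_L f i a k x * H i b x + cf_L f i b k x * H i a x))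
        \<le> norm v * (\<Sum>i\<in>(UNIV::2 set). M * \<sigma> + M * \<sigma>)" for k
      unfolding norm_mult
      by (intro mult_mono Finite_Cartesian_Product.norm_nth_le sum_norm_le norm_triangle_le add_mono)
        (auto simp: norm_mult intro!: mult_mono M H\<sigma> M0)
    then have "cmod (fdv (v, w) (H a b) x) \<le> (\<Sum>k\<in>(UNIV::2 set). norm v * (\<Sum>i\<in>(UNIV::2 set). M * \<sigma> + M * \<sigma>))"
      unfolding fdv_horizontal_H[OF assms(1,2)] by (intro sum_norm_le)
    also have "\<dots> = 8 * M * norm v * \<sigma>" by simp
    finally show ?thesis .
  qed
  have "(\<Sum>a\<in>UNIV. \<Sum>b\<in>UNIV. 2 * (H a b x \<bullet> fdv (v, w) (H a b) x))
      \<le> (\<Sum>a\<in>UNIV. \<Sum>b\<in>UNIV. 2 * (cmod (H a b x) * (8 * M * norm v * \<sigma>)))"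
  proof (intro sum_mono mult_left_mono)
    fix a b :: 2
    have "H a b x \<bullet> fdv (v, w) (H a b) x \<le> cmod (H a b x) * cmod (fdv (v, w) (H a b) x)"
      by (rule norm_cauchy_schwarz)
    also have "\<dots> \<le> cmod (H a b x) * (8 * M * norm v * \<sigma>)"
      using b by (intro mult_left_mono) auto
    finally show "H a b x \<bullet> fdv (v, w) (H a b) x \<le> cmod (H a b x) * (8 * M * norm v * \<sigma>)" .
  qed simp
  also have "\<dots> = 16 * M * norm v * \<sigma>\<^sup>2"
    by (simp add: \<sigma>_def sum_2 power2_eq_square algebra_simps)
  also have "\<dots> \<le> 16 * M * norm v * (4 * q x)"
  proof (intro mult_left_mono)
    have *: "(p + r + (s + t))\<^sup>2 \<le> 4 * (p\<^sup>2 + r\<^sup>2 + (s\<^sup>2 + t\<^sup>2))" for p r s t :: real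
    proof -
      have "4 * (p\<^sup>2 + r\<^sup>2 + (s\<^sup>2 + t\<^sup>2)) - (p + r + (s + t))\<^sup>2 =
        (p - r)\<^sup>2 + (p - s)\<^sup>2 + (p - t)\<^sup>2 + (r - s)\<^sup>2 + (r - t)\<^sup>2 + (s - t)\<^sup>2"
        by algebra
      also have "\<dots> \<ge> 0" by (intro add_nonneg_nonneg zero_le_power2)
      finally show ?thesis by simp
    qed
    show "\<sigma>\<^sup>2 \<le> 4 * q x" unfolding \<sigma>_def q_def sum_2 by (rule *)
  qed (use M0 in auto)
  finally show ?thesis by simp
qed

text \<open>Propagation along horizontal lifts without solving an ODE: by homogeneity the maximum of
  \<open>q\<close> over a fibre is critical in the fibre directions, so its derivative along the base equals
  the horizontal one, which is controlled by \<open>q\<close> itself.\<close>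

lemma H_zero_propagates:
  assumes z0: "z0 \<in> Z" and H0: "\<And>\<eta> a b. \<eta> \<noteq> 0 \<Longrightarrow> H a b (z0, \<eta>) = 0"
  obtains r where "r > 0" "ball z0 r \<subseteq> Z"
    "\<And>z \<eta> a b. z \<in> ball z0 r \<Longrightarrow> \<eta> \<noteq> 0 \<Longrightarrow> H a b (z, \<eta>) = 0"
proof -
  obtain r where r: "r > 0" "cball z0 r \<subseteq> Z" using open_contains_cball open_Z z0 by blast
  \<comment> \<open>A fixed nonzero vector: the coefficients do not depend on \<open>\<eta>\<close>,
    so a bound at \<open>e\<close> over the compact ball holds for every
    \<open>\<eta>\<close>.\<close>
  define e :: "complex^2" where "e = axis 1 1"
  have e: "e \<noteq> 0" by (simp add: e_def axis_eq_0_iff)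
  define m where "m z = (\<Sum>i\<in>UNIV. \<Sum>j\<in>UNIV. \<Sum>k\<in>UNIV. cmod (cf_L f i j k (z, e)))" for z
  have "continuous_on (cball z0 r) (\<lambda>z. cf_L f i j k (z, e))" for i j k
    by (rule continuous_on_compose2[OF smooth_on_continuous[OF smooth_cf_L]])
      (use r e in \<open>auto intro!: continuous_intros\<close>)
  then have "continuous_on (cball z0 r) m"
    unfolding m_def[abs_def] by (intro continuous_intros)
  then have "compact (m ` cball z0 r)" by (rule compact_continuous_image) simp
  then obtain M where "\<forall>y\<in>m ` cball z0 r. \<bar>y\<bar> \<le> M"
    using compact_imp_bounded bounded_real by blast
  then have M: "m z \<le> M" if "z \<in> cball z0 r" for z
    using that by (meson abs_le_D1 imageI)
  have cfM: "cmod (cf_L f i j k (z, \<eta>)) \<le> M" if "z \<in> cball z0 r" "\<eta> \<noteq> 0" for i j k z \<eta>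
  proof -
    have "cmod (cf_L f i j k (z, e)) \<le> m z"
    proof -
      have "cmod (cf_L f i j k (z, e)) \<le> (\<Sum>k\<in>UNIV. cmod (cf_L f i j k (z, e)))"
        by (rule member_le_sum) auto
      also have "\<dots> \<le> (\<Sum>j\<in>UNIV. \<Sum>k\<in>UNIV. cmod (cf_L f i j k (z, e)))"
        by (rule member_le_sum[of j _ "\<lambda>j. \<Sum>k\<in>UNIV. cmod (cf_L f i j k (z, e))"]) (auto intro: sum_nonneg)
      also have "\<dots> \<le> m z" unfolding m_def
        by (rule member_le_sum[of i _ "\<lambda>i. \<Sum>j\<in>UNIV. \<Sum>k\<in>UNIV. cmod (cf_L f i j k (z, e))"]) (auto intro!: sum_nonneg)
      finally show ?thesis .
    qed
    also have "cf_L f i j k (z, e) = cf_L f i j k (z, \<eta>)"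
      by (rule berwald) (use that r e in auto)
    finally show ?thesis using M[OF that(1)] by linarith
  qed
  have "q (z1, \<eta>1) = 0" if z1: "z1 \<in> ball z0 r" and \<eta>1: "\<eta>1 \<noteq> 0" for z1 \<eta>1
  proof -
    define v where "v = z1 - z0"
    define C where "C = 64 * M * norm v"
    define z where "z t = z0 + t *\<^sub>R v" for t :: real
    have zin: "z t \<in> cball z0 r" if "0 \<le> t" "t \<le> 1" for t
    proof -
      have "t * norm v \<le> 1 * norm v" using that by (intro mult_right_mono) auto
      then show ?thesis using z1 that by (simp add: z_def v_def dist_norm norm_minus_commute)
    qed
    have zZ: "z t \<in> Z" if "0 \<le> t" "t \<le> 1" for t using zin[OF that] r by blast
    have qc: "continuous_on S q"
      by (intro continuous_at_imp_continuous_on ballI has_derivative_continuous[OF q_has_derivative])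
    have qs: "q (z t, (1 / norm \<eta>) *\<^sub>R \<eta>) = q (z t, \<eta>)" if "0 \<le> t" "t \<le> 1" "\<eta> \<noteq> 0" for t \<eta>
    proof -
      have "(1 / norm \<eta>) *\<^sub>R \<eta> = of_real (1 / norm \<eta>) *s \<eta>"
        by (simp add: vec_eq_iff scaleR_conv_of_real[where 'a = complex])
      then show ?thesis
        using H_scale[OF zZ[OF that(1,2)] that(3), of "1 / norm \<eta>"] that(3) by (simp add: q_def)
    qed
    have small: "q (z1, \<eta>1) \<le> exp C * \<epsilon>" if \<epsilon>: "\<epsilon> > 0" for \<epsilon>
    proof -
      \<comment> \<open>The exponential absorbs the growth permitted by
        \<open>fdv_horizontal_q\<close>, and the term \<open>\<epsilon> * t\<close> makes the
        decrease strict, so that no maximum can occur at \<open>t > 0\<close>.\<close>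
      define g where "g t \<eta> = exp (- C * t) * q (z t, \<eta>) - \<epsilon> * t" for t \<eta>
      let ?K = "{0..1::real} \<times> sphere (0::complex^2) 1"
      have "continuous_on ?K (\<lambda>x. q (z (fst x), snd x))"
        by (rule continuous_on_compose2[OF qc]) (use zZ in \<open>auto simp: z_def intro!: continuous_intros\<close>)
      then have "continuous_on ?K (\<lambda>x. g (fst x) (snd x))"
        unfolding g_def by (intro continuous_intros)
      moreover have "compact ?K" by (intro compact_Times) auto
      moreover have "?K \<noteq> {}" by (auto intro!: exI[of _ e] simp: e_def)
      ultimately obtain p where p: "p \<in> ?K" "\<forall>y\<in>?K. g (fst y) (snd y) \<le> g (fst p) (snd p)"
        using continuous_attains_sup[of ?K "\<lambda>x. g (fst x) (snd x)"] by blast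
      define t \<eta> where "t = fst p" and "\<eta> = snd p"
      have t: "0 \<le> t" "t \<le> 1" and \<eta>: "norm \<eta> = 1" "\<eta> \<noteq> 0"
        using p(1) by (auto simp: t_def \<eta>_def mem_Times_iff)
      have mx: "g s \<zeta> \<le> g t \<eta>" if "0 \<le> s" "s \<le> 1" "\<zeta> \<noteq> 0" for s \<zeta>
      proof -
        have "g s ((1 / norm \<zeta>) *\<^sub>R \<zeta>) \<le> g t \<eta>"
          using bspec[OF p(2), of "(s, (1 / norm \<zeta>) *\<^sub>R \<zeta>)"] that by (simp add: t_def \<eta>_def)
        then show ?thesis using qs[OF that] by (simp add: g_def)
      qed
      have xS: "(z t, \<eta>) \<in> S" using zZ[OF t] \<eta> by simp
      define Dq where "Dq w = (\<Sum>a\<in>UNIV. \<Sum>b\<in>UNIV. 2 * (H a b (z t, \<eta>) \<bullet> fdv w (H a b) (z t, \<eta>)))" for w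
      have qd: "(q has_derivative Dq) (at (z t, \<eta>))"
        unfolding Dq_def by (rule q_has_derivative[OF xS])
      have "t = 0"
      proof (rule ccontr)
        assume "t \<noteq> 0"
        then have t0: "t > 0" using t by simp
        have fib: "Dq (0, w) = 0" for w
        proof -
          have "((\<lambda>\<zeta>. (z t, \<zeta>)) has_derivative (\<lambda>w. (0, w))) (at \<eta>)"
            by (auto intro!: derivative_eq_intros)
          from diff_chain_at[OF this qd]
          have "((\<lambda>\<zeta>. q (z t, \<zeta>)) has_derivative (\<lambda>w. Dq (0, w))) (at \<eta>)"
            by (simp add: o_def)
          moreover have "\<forall>\<zeta>\<in>UNIV - {0}. q (z t, \<zeta>) \<le> q (z t, \<eta>)"
            using mx[OF t] by (auto simp: g_def)
          ultimately have "(\<lambda>w. Dq (0, w)) = (\<lambda>w. 0)"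
            using differential_zero_maxmin[of \<eta> "UNIV - {0}" "\<lambda>\<zeta>. q (z t, \<zeta>)"] \<eta> by (auto simp: open_delete)
          then show ?thesis by metis
        qed
        define w where "w = (\<chi> i. - (\<Sum>k\<in>UNIV. cf_N f i k (z t, \<eta>) * v $ k))"
        have "Dq (v, w) \<le> C * q (z t, \<eta>)"
          unfolding Dq_def C_def
          by (rule fdv_horizontal_q[OF xS]) (use cfM[OF zin[OF t] \<eta>(2)] in \<open>auto simp: w_def\<close>)
        moreover have "Dq (v, w) = Dq (v, 0)"
          using linear_add[OF has_derivative_linear[OF qd], of "(v, 0)" "(0, w)"] fib by simp
        ultimately have D: "Dq (v, 0) \<le> C * q (z t, \<eta>)" by simp
        have "((\<lambda>s. (z s, \<eta>)) has_derivative (\<lambda>h. (h *\<^sub>R v, 0))) (at t)"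
          unfolding z_def by (auto intro!: derivative_eq_intros)
        from diff_chain_at[OF this qd]
        have "((\<lambda>s. q (z s, \<eta>)) has_derivative (\<lambda>h. Dq (h *\<^sub>R v, 0))) (at t)"
          by (simp add: o_def)
        moreover have "Dq (h *\<^sub>R v, 0) = Dq (v, 0) * h" for h
          using linear_scale[OF has_derivative_linear[OF qd], of h "(v, 0)"] by simp
        ultimately have q': "((\<lambda>s. q (z s, \<eta>)) has_real_derivative Dq (v, 0)) (at t)"
          by (simp add: has_field_derivative_def)
        have g': "((\<lambda>s. g s \<eta>) has_real_derivative exp (- C * t) * (Dq (v, 0) - C * q (z t, \<eta>)) - \<epsilon>) (at t)"
          unfolding g_def by (auto intro!: derivative_eq_intros q' simp: algebra_simps)
        have "exp (- C * t) * (Dq (v, 0) - C * q (z t, \<eta>)) \<le> 0"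
          using D by (simp add: mult_nonneg_nonpos)
        then have "exp (- C * t) * (Dq (v, 0) - C * q (z t, \<eta>)) - \<epsilon> < 0"
          using \<epsilon> by linarith
        \<comment> \<open>A larger value just to the left of \<open>t\<close> contradicts
          maximality; looking left also covers the end point \<open>t = 1\<close>.\<close>
        from DERIV_neg_dec_left[OF g' this]
        obtain d where d: "d > 0" "\<And>h. 0 < h \<Longrightarrow> h < d \<Longrightarrow> g t \<eta> < g (t - h) \<eta>" by blast
        define h where "h = min (d / 2) t"
        have "0 < h" "h < d" "0 \<le> t - h" "t - h \<le> 1" using d(1) t0 t by (auto simp: h_def)
        with d(2)[of h] mx[of "t - h" \<eta>] \<eta> show False by simp
      qed
      have "g 1 \<eta>1 \<le> g t \<eta>" using mx[of 1 \<eta>1] \<eta>1 by simp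
      also have "g t \<eta> = 0"
        using H0[OF \<eta>(2)] by (simp add: \<open>t = 0\<close> g_def z_def q_def)
      finally have "exp (- C) * q (z1, \<eta>1) \<le> \<epsilon>" by (simp add: g_def z_def v_def)
      then have "exp C * (exp (- C) * q (z1, \<eta>1)) \<le> exp C * \<epsilon>" by simp
      then show ?thesis by (simp add: mult.assoc[symmetric] flip: exp_add)
    qed
    have "q (z1, \<eta>1) \<le> 0"
    proof (rule field_le_epsilon)
      fix \<epsilon> :: real assume "\<epsilon> > 0"
      then show "q (z1, \<eta>1) \<le> 0 + \<epsilon>" using small[of "\<epsilon> / exp C"] by simp
    qed
    then show ?thesis using q_nonneg[of "(z1, \<eta>1)"] by simp
  qed
  then have "H a b (z, \<eta>) = 0" if "z \<in> ball z0 r" "\<eta> \<noteq> 0" for z \<eta> a b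
    using that q_eq_0_iff by blast
  moreover have "ball z0 r \<subseteq> Z" using r(2) ball_subset_cball by blast
  ultimately show ?thesis using that r(1) by blast
qed

end

section \<open>From charts to the manifold\<close>

lemma complex_manifold_chart:
  assumes "complex_manifold X \<A>" "c \<in> \<A>"
  shows "openin X (fst c)" "open (snd c ` fst c)"
    "homeomorphic_map (subtopology X (fst c)) (top_of_set (snd c ` fst c)) (snd c)"
  using assms unfolding complex_manifold_def by (auto simp: case_prod_beta)

lemma inj_on_chart:
  assumes "complex_manifold X \<A>" "c \<in> \<A>"
  shows "inj_on (snd c) (fst c)"
  using homeomorphic_imp_injective_map[OF complex_manifold_chart(3)[OF assms]]
    openin_subset[OF complex_manifold_chart(1)[OF assms]]
  by (simp add: topspace_subtopology Int_absorb1)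

lemma openin_chart_preimage:
  assumes "complex_manifold X \<A>" "c \<in> \<A>" "open O'"
  shows "openin X {p \<in> fst c. snd c p \<in> O'}"
proof -
  note ch = complex_manifold_chart[OF assms(1,2)]
  have "continuous_map (subtopology X (fst c)) euclidean (snd c)"
    using homeomorphic_imp_continuous_map[OF ch(3)] by (rule continuous_map_into_fulltopology)
  from openin_continuous_map_preimage[OF this, of O'] assms(3)
  have "openin (subtopology X (fst c)) {p \<in> topspace X \<inter> fst c. snd c p \<in> O'}"
    by (simp add: topspace_subtopology)
  moreover have "topspace X \<inter> fst c = fst c" using openin_subset[OF ch(1)] by blast
  ultimately show ?thesis using openin_trans_full[OF _ ch(1)] by simp
qed

lemma transition_derivative:
  assumes "complex_manifold X \<A>" "c \<in> \<A>" "d \<in> \<A>" "p \<in> fst c" "p \<in> fst d"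
  defines "J \<equiv> frechet_derivative (transition c d) (at (snd c p))"
  shows "bounded_linear J" "J (a *s v) = a *s J v"
proof -
  obtain D where D: "(transition c d has_derivative D) (at (snd c p))" "Vector_Spaces.linear (*s) (*s) D"
    using assms unfolding complex_manifold_def holomorphic_vec_on_def by (meson IntI imageI)
  have "J = D" using frechet_derivative_at[OF D(1)] by (simp add: J_def)
  then show "bounded_linear J" "J (a *s v) = a *s J v"
    using has_derivative_bounded_linear[OF D(1)] D(2) by (simp_all add: Vector_Spaces.linear_iff)
qed

lemma tangent_change:
  assumes "v \<in> holo_tangent_space \<A> p" "c \<in> \<A>" "d \<in> \<A>" "p \<in> fst c" "p \<in> fst d"
  shows "v d = frechet_derivative (transition c d) (at (snd c p)) (v c)"
  using assms unfolding holo_tangent_space_def by blast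

lemma tangent_scale:
  assumes M: "complex_manifold X \<A>" and v: "v \<in> holo_tangent_space \<A> p"
  shows "(\<lambda>c. a *s v c) \<in> holo_tangent_space \<A> p"
  unfolding holo_tangent_space_def mem_Collect_eq
proof (intro conjI ballI impI allI)
  fix c d assume "c \<in> \<A>" "d \<in> \<A>" "p \<in> fst c \<and> p \<in> fst d"
  then show "a *s v d = frechet_derivative (transition c d) (at (snd c p)) (a *s v c)"
    using transition_derivative(2)[OF M, of c d p] tangent_change[OF v, of c d] by simp
next
  fix c assume "\<not> (c \<in> \<A> \<and> p \<in> fst c)"
  then have "v c = 0" using v unfolding holo_tangent_space_def by blast
  then show "a *s v c = 0" by simp
qed

lemma local_rep_eq:
  assumes M: "complex_manifold X \<A>" and c: "c \<in> \<A>" and p: "p \<in> fst c"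
    and v: "v \<in> holo_tangent_space \<A> p"
  shows "local_rep \<A> F c (snd c p, v c) = F (p, v)"
proof -
  have "inv_into (Sigma (fst c) (holo_tangent_space \<A>)) (bundle_chart c) (bundle_chart c (p, v)) = (p, v)"
    by (rule inv_into_f_f[OF bij_betw_imp_inj_on[OF bij_betw_bundle_chart[OF M c]]]) (use p v in auto)
  then show ?thesis by (simp add: local_rep_def bundle_chart_def)
qed

lemma tangent_exists:
  assumes M: "complex_manifold X \<A>" and c: "c \<in> \<A>" and p: "p \<in> fst c"
  obtains v where "v \<in> holo_tangent_space \<A> p" "v c = \<eta>"
proof -
  have "(snd c p, \<eta>) \<in> bundle_chart c ` Sigma (fst c) (holo_tangent_space \<A>)"
    using bij_betw_imp_surj_on[OF bij_betw_bundle_chart[OF M c]] p by (simp add: chart_range_def)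
  then obtain p' v where *: "p' \<in> fst c" "v \<in> holo_tangent_space \<A> p'" "snd c p' = snd c p" "v c = \<eta>"
    by (auto simp: bundle_chart_def)
  then have "p' = p" using inj_on_chart[OF M c] p by (auto dest: inj_onD)
  then show ?thesis using * that by blast
qed

text \<open>Positivity and scaling are given for bundle vectors; \<open>tangent_exists\<close> lifts
  every coordinate vector to one, and \<open>local_rep_eq\<close> transfers the values.\<close>

lemma berwald_chart_local_rep:
  fixes \<A> :: "('m, 2) chart set"
  assumes B: "complex_berwald X \<A> F" and c: "c \<in> \<A>"
  shows "berwald_chart (local_rep \<A> F c) (snd c ` fst c)"
proof -
  have K: "kaehler_finsler X \<A> F" using B by (simp add: complex_berwald_def)
  have C: "complex_finsler X \<A> F" using K by (simp add: kaehler_finsler_def)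
  have M: "complex_manifold X \<A>" using C by (simp add: complex_finsler_def)
  have F: "0 \<le> F (p, v)" "F (p, v) = 0 \<longleftrightarrow> v = (\<lambda>_. 0)" "F (p, \<lambda>c. a *s v c) = cmod a * F (p, v)"
    if "p \<in> fst c" "v \<in> holo_tangent_space \<A> p" for p v a
  proof -
    have "(p, v) \<in> holo_tangent_bundle X \<A>"
      using that openin_subset[OF complex_manifold_chart(1)[OF M c]] by (auto simp: holo_tangent_bundle_def)
    moreover have "\<forall>(p, v)\<in>holo_tangent_bundle X \<A>. 0 \<le> F (p, v) \<and>
        (F (p, v) = 0 \<longleftrightarrow> v = (\<lambda>_. 0)) \<and> (\<forall>a. F (p, \<lambda>c. a *s v c) = cmod a * F (p, v))"
      by (rule conjunct1[OF conjunct2[OF C[unfolded complex_finsler_def]]])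
    ultimately show "0 \<le> F (p, v)" "F (p, v) = 0 \<longleftrightarrow> v = (\<lambda>_. 0)"
      "F (p, \<lambda>c. a *s v c) = cmod a * F (p, v)"
      by fast+
  qed
  have S: "(snd c ` fst c) \<times> (UNIV - {0}) = slit_range c" by (simp add: slit_range_def)
  show ?thesis
  proof
    show "open (snd c ` fst c)" by (rule complex_manifold_chart(2)[OF M c])
    show "smooth_on (\<lambda>x. (local_rep \<A> F c x)\<^sup>2) ((snd c ` fst c) \<times> (UNIV - {0}))"
      unfolding S using C c by (simp add: complex_finsler_def)
    show "hermitian_pos_def (metric (local_rep \<A> F c) (z, \<eta>))" if "z \<in> snd c ` fst c" "\<eta> \<noteq> 0" for z \<eta>
      using C c that by (auto simp: complex_finsler_def slit_range_def)
    show "0 < local_rep \<A> F c (z, \<eta>)" if "z \<in> snd c ` fst c" "\<eta> \<noteq> 0" for z \<eta>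
    proof -
      obtain p where p: "p \<in> fst c" "z = snd c p" using \<open>z \<in> snd c ` fst c\<close> by auto
      obtain v where v: "v \<in> holo_tangent_space \<A> p" "v c = \<eta>" by (rule tangent_exists[OF M c p(1)])
      have "v \<noteq> (\<lambda>_. 0)" using v(2) \<open>\<eta> \<noteq> 0\<close> by auto
      then have "F (p, v) > 0" using F(1,2)[OF p(1) v(1)] by linarith
      then show ?thesis using local_rep_eq[OF M c p(1) v(1), of F] v p by simp
    qed
    show "local_rep \<A> F c (z, a *s \<eta>) = cmod a * local_rep \<A> F c (z, \<eta>)" if "z \<in> snd c ` fst c" for z a \<eta>
    proof -
      obtain p where p: "p \<in> fst c" "z = snd c p" using \<open>z \<in> snd c ` fst c\<close> by auto
      obtain v where v: "v \<in> holo_tangent_space \<A> p" "v c = \<eta>" by (rule tangent_exists[OF M c p(1)])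
      show ?thesis
        using local_rep_eq[OF M c p(1) v(1), of F] local_rep_eq[OF M c p(1) tangent_scale[OF M v(1)], of F a]
          F(3)[OF p(1) v(1), of a] v p by simp
    qed
    show "(\<Sum>j\<in>UNIV. cf_T (local_rep \<A> F c) i j k x * snd x $ j) = 0"
      if "x \<in> (snd c ` fst c) \<times> (UNIV - {0})" for x i k
      using K c that unfolding S kaehler_finsler_def by blast
    show "cf_L (local_rep \<A> F c) i j k (z, \<eta>) = cf_L (local_rep \<A> F c) i j k (z, \<eta>')"
      if "(z, \<eta>) \<in> (snd c ` fst c) \<times> (UNIV - {0})" "(z, \<eta>') \<in> (snd c ` fst c) \<times> (UNIV - {0})" for z \<eta> \<eta>' i j k
      using B c that unfolding S complex_berwald_def by blast
  qed
qed

text \<open>The values of \<open>A\<close> in the two charts are not compared. Vanishing is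
  translated into that of \<open>H\<close>, which transforms as a tensor on the fibre under the
  Jacobian.\<close>

lemma A_inv_zero_chart_change:
  fixes \<A> :: "('m, 2) chart set"
  assumes B: "complex_berwald X \<A> F" and c: "c \<in> \<A>" and d: "d \<in> \<A>" and p: "p \<in> fst c" "p \<in> fst d"
    and A0: "\<And>\<eta>. \<eta> \<noteq> 0 \<Longrightarrow> A_inv (local_rep \<A> F d) (snd d p, \<eta>) = 0" and \<eta>: "\<eta> \<noteq> 0"
  shows "A_inv (local_rep \<A> F c) (snd c p, \<eta>) = 0"
proof -
  have M: "complex_manifold X \<A>"
    using B by (simp add: complex_berwald_def kaehler_finsler_def complex_finsler_def)
  interpret C: berwald_chart "local_rep \<A> F c" "snd c ` fst c" by (rule berwald_chart_local_rep[OF B c])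
  interpret D: berwald_chart "local_rep \<A> F d" "snd d ` fst d" by (rule berwald_chart_local_rep[OF B d])
  define J where "J = frechet_derivative (transition c d) (at (snd c p))"
  note J = transition_derivative[OF M c d p, folded J_def]
  have eq: "local_rep \<A> F d (snd d p, J \<eta>) = local_rep \<A> F c (snd c p, \<eta>)" for \<eta>
  proof -
    obtain v where v: "v \<in> holo_tangent_space \<A> p" "v c = \<eta>" by (rule tangent_exists[OF M c p(1)])
    show ?thesis
      using local_rep_eq[OF M c p(1) v(1), of F] local_rep_eq[OF M d p(2) v(1), of F]
        tangent_change[OF v(1) c d p] v(2) by (simp add: J_def)
  qed
  \<comment> \<open>Injectivity: the reverse transition maps the components of the same tangent
    vector back.\<close>
  have J0: "J \<zeta> \<noteq> 0" if "\<zeta> \<noteq> 0" for \<zeta>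
  proof
    assume "J \<zeta> = 0"
    obtain v where v: "v \<in> holo_tangent_space \<A> p" "v c = \<zeta>" by (rule tangent_exists[OF M c p(1)])
    have "v d = 0" using tangent_change[OF v(1) c d p] v(2) \<open>J \<zeta> = 0\<close> by (simp add: J_def)
    then have "v c = 0"
      using tangent_change[OF v(1) d c p(2,1)] linear_0[OF bounded_linear.linear[OF transition_derivative(1)[OF M d c p(2,1)]]]
      by simp
    then show False using v(2) that by simp
  qed
  have z: "snd c p \<in> snd c ` fst c" "snd d p \<in> snd d ` fst d" using p by auto
  have "d_eta a (d_eta b (L_fun (local_rep \<A> F d))) (snd d p, J \<eta>) = 0" for a b
    using A0[OF J0[OF \<eta>]] D.A_inv_eq_0_iff[of "(snd d p, J \<eta>)"] z J0[OF \<eta>] by simp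
  then have "d_eta i (d_eta j (L_fun (local_rep \<A> F c))) (snd c p, \<eta>) = 0" for i j
    using H_chart_change[OF C.finsler_chart_axioms D.finsler_chart_axioms J(1) J(2) J0 z eq \<eta>, of i j] by simp
  then show ?thesis using C.A_inv_eq_0_iff[of "(snd c p, \<eta>)"] z \<eta> by simp
qed

text \<open>The base points whose fibre contains a vector with \<open>A \<noteq> 0\<close> form a
  nonempty set that is both open and closed.\<close>

lemma A_inv_nonzero_everywhere:
  fixes \<A> :: "('m, 2) chart set"
  assumes con: "connected_space X" and B: "complex_berwald X \<A> F"
    and ex: "\<exists>c\<in>\<A>. \<exists>x\<in>slit_range c. cmod (A_inv (local_rep \<A> F c) x) \<noteq> 0"
    and c: "c \<in> \<A>" and p: "p \<in> fst c"
  shows "\<exists>\<eta>. \<eta> \<noteq> 0 \<and> A_inv (local_rep \<A> F c) (snd c p, \<eta>) \<noteq> 0"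
proof -
  have M: "complex_manifold X \<A>"
    using B by (simp add: complex_berwald_def kaehler_finsler_def complex_finsler_def)
  have top: "topspace X = (\<Union>c\<in>\<A>. fst c)" using M by (simp add: complex_manifold_def)
  define N where "N c p \<longleftrightarrow> (\<exists>\<eta>. \<eta> \<noteq> 0 \<and> A_inv (local_rep \<A> F c) (snd c p, \<eta>) \<noteq> 0)" for c p
  have Nch: "N d p" if "N c p" "c \<in> \<A>" "d \<in> \<A>" "p \<in> fst c" "p \<in> fst d" for c d p
  proof (rule ccontr)
    assume "\<not> N d p"
    then have "A_inv (local_rep \<A> F d) (snd d p, \<eta>) = 0" if "\<eta> \<noteq> 0" for \<eta>
      using that unfolding N_def by blast
    from A_inv_zero_chart_change[OF B that(2-5) this] \<open>N c p\<close> show False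
      unfolding N_def by blast
  qed
  define P where "P = (\<Union>c\<in>\<A>. {p \<in> fst c. N c p})"
  \<comment> \<open>In coordinates this is the projection to the base of the open set
    \<open>nonquad\<close>.\<close>
  have "openin X {p \<in> fst c. N c p}" if c: "c \<in> \<A>" for c
  proof -
    interpret C: berwald_chart "local_rep \<A> F c" "snd c ` fst c" by (rule berwald_chart_local_rep[OF B c])
    have "N c p \<longleftrightarrow> snd c p \<in> fst ` C.nonquad" if "p \<in> fst c" for p
    proof -
      have "(snd c p, \<eta>) \<in> C.nonquad \<longleftrightarrow> \<eta> \<noteq> 0 \<and> A_inv (local_rep \<A> F c) (snd c p, \<eta>) \<noteq> 0" for \<eta>
        using that C.A_inv_eq_0_iff[of "(snd c p, \<eta>)"] by (auto simp: C.nonquad_def)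
      moreover have "z \<in> fst ` C.nonquad \<longleftrightarrow> (\<exists>\<eta>. (z, \<eta>) \<in> C.nonquad)" for z by force
      ultimately show ?thesis by (simp add: N_def)
    qed
    then have "{p \<in> fst c. N c p} = {p \<in> fst c. snd c p \<in> fst ` C.nonquad}" by blast
    then show ?thesis
      using openin_chart_preimage[OF M c open_image_fst[OF C.open_nonquad]] by simp
  qed
  then have oP: "openin X P" unfolding P_def by auto
  \<comment> \<open>\<open>H\<close> vanishes on the fibre over such a point and hence, by
    \<open>H_zero_propagates\<close>, on all fibres over a ball; \<open>Nch\<close> makes the
    conclusion independent of the chart.\<close>
  have "openin X (topspace X - P)"
  proof (subst openin_subopen, intro ballI)
    fix p assume p: "p \<in> topspace X - P"
    then obtain c where c: "c \<in> \<A>" "p \<in> fst c" using top by auto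
    interpret C: berwald_chart "local_rep \<A> F c" "snd c ` fst c" by (rule berwald_chart_local_rep[OF B c(1)])
    have z0: "snd c p \<in> snd c ` fst c" using c by auto
    have n: "\<not> N c p" using p c by (auto simp: P_def)
    have "C.H a b (snd c p, \<eta>) = 0" if "\<eta> \<noteq> 0" for \<eta> a b
    proof -
      have "A_inv (local_rep \<A> F c) (snd c p, \<eta>) = 0" using n that unfolding N_def by blast
      then show ?thesis using that C.A_inv_eq_0_iff[of "(snd c p, \<eta>)"] z0 by simp
    qed
    then obtain r where r: "r > 0" "ball (snd c p) r \<subseteq> snd c ` fst c"
      "\<And>z \<eta> a b. z \<in> ball (snd c p) r \<Longrightarrow> \<eta> \<noteq> 0 \<Longrightarrow> C.H a b (z, \<eta>) = 0"
      using C.H_zero_propagates[OF z0] by blast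
    let ?U = "{q \<in> fst c. snd c q \<in> ball (snd c p) r}"
    have "?U \<subseteq> topspace X - P"
    proof
      fix q assume q: "q \<in> ?U"
      have "A_inv (local_rep \<A> F c) (snd c q, \<eta>) = 0" if "\<eta> \<noteq> 0" for \<eta>
        using r(3)[of "snd c q" \<eta>] C.A_inv_eq_0_iff[of "(snd c q, \<eta>)"] q that by simp
      then have "\<not> N c q" unfolding N_def by blast
      then have "q \<notin> P" using q Nch[of _ q c] c(1) unfolding P_def by blast
      then show "q \<in> topspace X - P" using q c(1) top by auto
    qed
    moreover have "openin X ?U" by (rule openin_chart_preimage[OF M c(1)]) simp
    moreover have "p \<in> ?U" using c r by simp
    ultimately show "\<exists>T. openin X T \<and> p \<in> T \<and> T \<subseteq> topspace X - P" by blast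
  qed
  then have "closedin X P" using openin_subset[OF oP] by (simp add: closedin_def)
  moreover have "P \<noteq> {}"
  proof -
    obtain c x where c: "c \<in> \<A>" and x: "x \<in> slit_range c" "A_inv (local_rep \<A> F c) x \<noteq> 0"
      using ex by auto
    obtain p \<eta> where "p \<in> fst c" "x = (snd c p, \<eta>)" "\<eta> \<noteq> 0"
      using x(1) by (auto simp: slit_range_def)
    then have "p \<in> P" using c x(2) unfolding P_def N_def by blast
    then show ?thesis by blast
  qed
  ultimately have "P = topspace X"
    using con oP unfolding connected_space_clopen_in by blast
  then obtain d where "d \<in> \<A>" "p \<in> fst d" "N d p" using c p top unfolding P_def by blast
  then have "N c p" using Nch c p by blast
  then show ?thesis unfolding N_def .
qed

theorem theorem4p12:
  fixes X :: "'m topology"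
    and \<A> :: "('m, 2) chart set"
    and F :: "'m \<times> ('m, 2) tvec \<Rightarrow> real"
  assumes "connected_space X"
    and "complex_berwald X \<A> F"
    and "\<And>c x k. c \<in> \<A> \<Longrightarrow> x \<in> slit_range c \<Longrightarrow>
           curv_0k00 (local_rep \<A> F c) k x = curv_000k (local_rep \<A> F c) k x"
    and "\<exists>c\<in>\<A>. \<exists>x\<in>slit_range c. cmod (A_inv (local_rep \<A> F c) x) \<noteq> 0"
  shows "\<forall>c\<in>\<A>. \<forall>x\<in>slit_range c. \<forall>r j h k. curv (local_rep \<A> F c) r j h k x = 0"
proof (intro ballI allI)
  fix c x r j h k
  assume c: "c \<in> \<A>" and x: "x \<in> slit_range c"
  interpret C: berwald_chart "local_rep \<A> F c" "snd c ` fst c"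
    by (rule berwald_chart_local_rep[OF assms(2) c])
  obtain p \<eta> where p: "p \<in> fst c" "\<eta> \<noteq> 0" "x = (snd c p, \<eta>)"
    using x by (auto simp: slit_range_def)
  obtain \<eta>' where "\<eta>' \<noteq> 0" "A_inv (local_rep \<A> F c) (snd c p, \<eta>') \<noteq> 0"
    using A_inv_nonzero_everywhere[OF assms(1,2,4) c p(1)] by blast
  moreover have "curv_0k00 (local_rep \<A> F c) k x = curv_000k (local_rep \<A> F c) k x" if "x \<in> C.S" for x k
    using assms(3)[OF c] that by (simp add: slit_range_def)
  ultimately show "curv (local_rep \<A> F c) r j h k x = 0"
    using C.curv_zero[of "snd c p" \<eta>' \<eta>] p by blast
qed

end
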